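(* Let $(M,\eta,\omega)$ be a conformal symplectic manifold and $H:M\to\mathbb{R}$ a Hamiltonian. An isotropic submanifold of $M$ that is invariant under the Hamiltonian flow of $H$ and on which the pull-back of the Lee form $\eta$ is not exact is included in $\{H=0\}$.
   Context: A conformal symplectic manifold $(M,\eta,\omega)$ is a smooth manifold $M$ of even dimension with a closed 1-form $\eta$ (the Lee form) and a non-degenerate 2-form $\omega$ such that $\mathrm{d}_\eta\omega=0$, where $\mathrm{d}_\eta\alpha:=\mathrm{d}\alpha-\eta\wedge\alpha$. Given a smooth $H:M\to\mathbb{R}$ (the Hamiltonian), its Hamiltonian vector field $X$ is defined by $\iota_X\omega=\mathrm{d}_\eta H=\mathrm{d}H-H\eta$, and the Hamiltonian flow of $H$ is the flow of $X$. A submanifold is isotropic if the pull-back of $\omega$ to it vanishes.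
   Formalization: The isotropic submanifold is assumed connected; otherwise the claim fails, since the Lee form may be non-exact on one component inside {H=0} and exact on another component where H is nonzero. *)

theory Defs
  imports "HOL-Analysis.Analysis"
begin

section \<open>Smooth maps between open subsets of Euclidean spaces\<close>

text \<open>The set \<open>S\<close> is meant to be open. As the spaces are finite-dimensional, continuity of
  all iterated directional derivatives is continuity of the iterated derivatives.\<close>

primrec Ck_on :: "nat \<Rightarrow> 'e::euclidean_space set \<Rightarrow> ('e \<Rightarrow> 'b::real_normed_vector) \<Rightarrow> bool" where
  "Ck_on 0 S f \<longleftrightarrow> continuous_on S f"
| "Ck_on (Suc k) S f \<longleftrightarrow> (\<forall>x\<in>S. f differentiable (at x)) \<and>
     (\<forall>v. Ck_on k S (\<lambda>x. frechet_derivative f (at x) v))"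

definition smooth_on :: "'e::euclidean_space set \<Rightarrow> ('e \<Rightarrow> 'b::real_normed_vector) \<Rightarrow> bool" where
  "smooth_on S f \<longleftrightarrow> (\<forall>k. Ck_on k S f)"


section \<open>Smooth manifolds\<close>

type_synonym ('a, 'e) chart = "'a set \<times> ('a \<Rightarrow> 'e)"

abbreviation chart_dom :: "('a, 'e) chart \<Rightarrow> 'a set" where
  "chart_dom c \<equiv> fst c"

abbreviation chart_fun :: "('a, 'e) chart \<Rightarrow> 'a \<Rightarrow> 'e" where
  "chart_fun c \<equiv> snd c"

definition chart_img :: "('a, 'e) chart \<Rightarrow> 'e set" where
  "chart_img c = chart_fun c ` chart_dom c"

definition chart_inv :: "('a, 'e) chart \<Rightarrow> 'e \<Rightarrow> 'a" where
  "chart_inv c = inv_into (chart_dom c) (chart_fun c)"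

definition is_chart :: "'a topology \<Rightarrow> ('a, 'e::euclidean_space) chart \<Rightarrow> bool" where
  "is_chart T c \<longleftrightarrow> openin T (chart_dom c) \<and> open (chart_img c) \<and>
     homeomorphic_map (subtopology T (chart_dom c)) (top_of_set (chart_img c)) (chart_fun c)"

text \<open>The atlas need not be maximal. The dimension of the manifold is the dimension of the
  model space \<open>'e\<close>.\<close>

record ('a, 'e) manifold =
  mtop :: "'a topology"
  atlas :: "('a, 'e) chart set"

abbreviation points :: "('a, 'e) manifold \<Rightarrow> 'a set" where
  "points M \<equiv> topspace (mtop M)"

definition smooth_manifold :: "('a, 'e::euclidean_space) manifold \<Rightarrow> bool" where
  "smooth_manifold M \<longleftrightarrow>
     Hausdorff_space (mtop M) \<and> second_countable (mtop M) \<and>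
     (\<forall>c\<in>atlas M. is_chart (mtop M) c) \<and>
     (\<Union>c\<in>atlas M. chart_dom c) = points M \<and>
     (\<forall>c\<in>atlas M. \<forall>d\<in>atlas M.
        smooth_on (chart_fun c ` (chart_dom c \<inter> chart_dom d)) (chart_fun d \<circ> chart_inv c))"

definition charts_at :: "('a, 'e) manifold \<Rightarrow> 'a \<Rightarrow> ('a, 'e) chart set" where
  "charts_at M p = {c \<in> atlas M. p \<in> chart_dom c}"

definition some_chart :: "('a, 'e) manifold \<Rightarrow> 'a \<Rightarrow> ('a, 'e) chart" where
  "some_chart M p = (SOME c. c \<in> charts_at M p)"


section \<open>Tangent spaces, smooth maps and their differentials\<close>

text \<open>A tangent vector at \<open>p\<close> is the family of its coordinate expressions in all charts around
  \<open>p\<close>; they correspond to each other under the derivatives of the transition maps. The value 0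
  at the other charts is a mere normalisation, so that tangent vectors with equal coordinates
  are equal.\<close>

type_synonym ('a, 'e) tvec = "('a, 'e) chart \<Rightarrow> 'e"

definition tangent_space ::
    "('a, 'e::euclidean_space) manifold \<Rightarrow> 'a \<Rightarrow> ('a, 'e) tvec set" where
  "tangent_space M p = {v.
     (\<forall>c. c \<notin> charts_at M p \<longrightarrow> v c = 0) \<and>
     (\<forall>c\<in>charts_at M p. \<forall>d\<in>charts_at M p.
        v d = frechet_derivative (chart_fun d \<circ> chart_inv c) (at (chart_fun c p)) (v c))}"

text \<open>The tangent vector at \<open>p\<close> whose expression in the chart \<open>c\<close> is \<open>u\<close>; for fixed \<open>u\<close> this is
  a constant-coefficient combination of the coordinate vector fields of \<open>c\<close>.\<close>

definition coord_vector ::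
    "('a, 'e::euclidean_space) manifold \<Rightarrow> ('a, 'e) chart \<Rightarrow> 'a \<Rightarrow> 'e \<Rightarrow> ('a, 'e) tvec" where
  "coord_vector M c p u = (\<lambda>d. if d \<in> charts_at M p
     then frechet_derivative (chart_fun d \<circ> chart_inv c) (at (chart_fun c p)) u else 0)"

definition smooth_fun :: "('a, 'e::euclidean_space) manifold \<Rightarrow> ('a \<Rightarrow> real) \<Rightarrow> bool" where
  "smooth_fun M f \<longleftrightarrow> (\<forall>c\<in>atlas M. smooth_on (chart_img c) (f \<circ> chart_inv c))"

definition smooth_map ::
    "('a, 'e::euclidean_space) manifold \<Rightarrow> ('b, 'f::euclidean_space) manifold \<Rightarrow>
     ('a \<Rightarrow> 'b) \<Rightarrow> bool" where
  "smooth_map M N F \<longleftrightarrow> continuous_map (mtop M) (mtop N) F \<and>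
     (\<forall>c\<in>atlas M. \<forall>d\<in>atlas N.
        smooth_on (chart_fun c ` (chart_dom c \<inter> F -` chart_dom d))
          (chart_fun d \<circ> F \<circ> chart_inv c))"

text \<open>By the chain rule, the differentials do not depend on the chart chosen at \<open>p\<close>.\<close>

definition differential ::
    "('a, 'e::euclidean_space) manifold \<Rightarrow> ('a \<Rightarrow> real) \<Rightarrow> 'a \<Rightarrow> ('a, 'e) tvec \<Rightarrow> real" where
  "differential M f p v = (let c = some_chart M p in
     frechet_derivative (f \<circ> chart_inv c) (at (chart_fun c p)) (v c))"

definition tangent_map ::
    "('a, 'e::euclidean_space) manifold \<Rightarrow> ('b, 'f::euclidean_space) manifold \<Rightarrow>
     ('a \<Rightarrow> 'b) \<Rightarrow> 'a \<Rightarrow> ('a, 'e) tvec \<Rightarrow> ('b, 'f) tvec" where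
  "tangent_map M N F p v = (let c = some_chart M p in
     (\<lambda>d. if d \<in> charts_at N (F p)
       then frechet_derivative (chart_fun d \<circ> F \<circ> chart_inv c) (at (chart_fun c p)) (v c)
       else 0))"


section \<open>Differential forms of degree one and two\<close>

text \<open>Forms are only meaningful on points of the manifold and tangent vectors there; their other
  values are irrelevant.\<close>

type_synonym ('a, 'e) form1 = "'a \<Rightarrow> ('a, 'e) tvec \<Rightarrow> real"
type_synonym ('a, 'e) form2 = "'a \<Rightarrow> ('a, 'e) tvec \<Rightarrow> ('a, 'e) tvec \<Rightarrow> real"

definition linear_on_tangent ::
    "('a, 'e::euclidean_space) manifold \<Rightarrow> 'a \<Rightarrow> (('a, 'e) tvec \<Rightarrow> real) \<Rightarrow> bool" where
  "linear_on_tangent M p l \<longleftrightarrow> (\<forall>v\<in>tangent_space M p. \<forall>w\<in>tangent_space M p. \<forall>a b.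
     l (\<lambda>c. a *\<^sub>R v c + b *\<^sub>R w c) = a * l v + b * l w)"

definition coord1 ::
    "('a, 'e::euclidean_space) manifold \<Rightarrow> ('a, 'e) chart \<Rightarrow> ('a, 'e) form1 \<Rightarrow>
     'e \<Rightarrow> 'e \<Rightarrow> real" where
  "coord1 M c \<alpha> x u = (let p = chart_inv c x in \<alpha> p (coord_vector M c p u))"

definition coord2 ::
    "('a, 'e::euclidean_space) manifold \<Rightarrow> ('a, 'e) chart \<Rightarrow> ('a, 'e) form2 \<Rightarrow>
     'e \<Rightarrow> 'e \<Rightarrow> 'e \<Rightarrow> real" where
  "coord2 M c \<beta> x u v =
     (let p = chart_inv c x in \<beta> p (coord_vector M c p u) (coord_vector M c p v))"

definition is_form1 :: "('a, 'e::euclidean_space) manifold \<Rightarrow> ('a, 'e) form1 \<Rightarrow> bool" where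
  "is_form1 M \<alpha> \<longleftrightarrow>
     (\<forall>p\<in>points M. linear_on_tangent M p (\<alpha> p)) \<and>
     (\<forall>c\<in>atlas M. \<forall>u. smooth_on (chart_img c) (\<lambda>x. coord1 M c \<alpha> x u))"

definition is_form2 :: "('a, 'e::euclidean_space) manifold \<Rightarrow> ('a, 'e) form2 \<Rightarrow> bool" where
  "is_form2 M \<beta> \<longleftrightarrow>
     (\<forall>p\<in>points M. \<forall>v\<in>tangent_space M p. linear_on_tangent M p (\<lambda>u. \<beta> p u v)) \<and>
     (\<forall>p\<in>points M. \<forall>u\<in>tangent_space M p. \<forall>v\<in>tangent_space M p. \<beta> p u v = - \<beta> p v u) \<and>
     (\<forall>c\<in>atlas M. \<forall>u v. smooth_on (chart_img c) (\<lambda>x. coord2 M c \<beta> x u v))"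

text \<open>Exterior derivatives, computed in a chart with constant-coefficient vector fields (whose
  Lie brackets vanish); they do not depend on the chart chosen at \<open>p\<close>.\<close>

definition ext_deriv1 ::
    "('a, 'e::euclidean_space) manifold \<Rightarrow> ('a, 'e) form1 \<Rightarrow> ('a, 'e) form2" where
  "ext_deriv1 M \<alpha> p u v = (let c = some_chart M p; x = chart_fun c p in
     frechet_derivative (\<lambda>y. coord1 M c \<alpha> y (v c)) (at x) (u c)
   - frechet_derivative (\<lambda>y. coord1 M c \<alpha> y (u c)) (at x) (v c))"

definition ext_deriv2 ::
    "('a, 'e::euclidean_space) manifold \<Rightarrow> ('a, 'e) form2 \<Rightarrow>
     'a \<Rightarrow> ('a, 'e) tvec \<Rightarrow> ('a, 'e) tvec \<Rightarrow> ('a, 'e) tvec \<Rightarrow> real" where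
  "ext_deriv2 M \<beta> p u v w = (let c = some_chart M p; x = chart_fun c p in
     frechet_derivative (\<lambda>y. coord2 M c \<beta> y (v c) (w c)) (at x) (u c)
   - frechet_derivative (\<lambda>y. coord2 M c \<beta> y (u c) (w c)) (at x) (v c)
   + frechet_derivative (\<lambda>y. coord2 M c \<beta> y (u c) (v c)) (at x) (w c))"

definition wedge12 ::
    "('a, 'e) form1 \<Rightarrow> ('a, 'e) form2 \<Rightarrow>
     'a \<Rightarrow> ('a, 'e) tvec \<Rightarrow> ('a, 'e) tvec \<Rightarrow> ('a, 'e) tvec \<Rightarrow> real" where
  "wedge12 \<alpha> \<beta> p u v w = \<alpha> p u * \<beta> p v w - \<alpha> p v * \<beta> p u w + \<alpha> p w * \<beta> p u v"

definition closed_form1 :: "('a, 'e::euclidean_space) manifold \<Rightarrow> ('a, 'e) form1 \<Rightarrow> bool" where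
  "closed_form1 M \<alpha> \<longleftrightarrow>
     (\<forall>p\<in>points M. \<forall>u\<in>tangent_space M p. \<forall>v\<in>tangent_space M p. ext_deriv1 M \<alpha> p u v = 0)"

definition exact_form1 :: "('a, 'e::euclidean_space) manifold \<Rightarrow> ('a, 'e) form1 \<Rightarrow> bool" where
  "exact_form1 M \<alpha> \<longleftrightarrow> (\<exists>f. smooth_fun M f \<and>
     (\<forall>p\<in>points M. \<forall>v\<in>tangent_space M p. \<alpha> p v = differential M f p v))"

definition nondegenerate :: "('a, 'e::euclidean_space) manifold \<Rightarrow> ('a, 'e) form2 \<Rightarrow> bool" where
  "nondegenerate M \<beta> \<longleftrightarrow> (\<forall>p\<in>points M. \<forall>u\<in>tangent_space M p.
     (\<forall>v\<in>tangent_space M p. \<beta> p u v = 0) \<longrightarrow> (\<forall>c. u c = 0))"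

definition pullback1 ::
    "('a, 'e::euclidean_space) manifold \<Rightarrow> ('b, 'f::euclidean_space) manifold \<Rightarrow>
     ('a \<Rightarrow> 'b) \<Rightarrow> ('b, 'f) form1 \<Rightarrow> ('a, 'e) form1" where
  "pullback1 M N F \<alpha> p v = \<alpha> (F p) (tangent_map M N F p v)"

definition pullback2 ::
    "('a, 'e::euclidean_space) manifold \<Rightarrow> ('b, 'f::euclidean_space) manifold \<Rightarrow>
     ('a \<Rightarrow> 'b) \<Rightarrow> ('b, 'f) form2 \<Rightarrow> ('a, 'e) form2" where
  "pullback2 M N F \<beta> p u v = \<beta> (F p) (tangent_map M N F p u) (tangent_map M N F p v)"


section \<open>Submanifolds\<close>

text \<open>An embedded submanifold: a subset with the subspace topology and a smooth structure
  for which the inclusion, here the identity function, is an immersion.\<close>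

definition submanifold ::
    "('a, 'f::euclidean_space) manifold \<Rightarrow> ('a, 'e::euclidean_space) manifold \<Rightarrow> bool" where
  "submanifold L M \<longleftrightarrow> smooth_manifold L \<and> points L \<subseteq> points M \<and>
     mtop L = subtopology (mtop M) (points L) \<and>
     smooth_map L M id \<and>
     (\<forall>p\<in>points L. inj_on (tangent_map L M id p) (tangent_space L p))"


section \<open>Conformal symplectic manifolds and Hamiltonian flows\<close>

definition lee_deriv0 ::
    "('a, 'e::euclidean_space) manifold \<Rightarrow> ('a, 'e) form1 \<Rightarrow> ('a \<Rightarrow> real) \<Rightarrow> ('a, 'e) form1" where
  "lee_deriv0 M \<eta> H p v = differential M H p v - H p * \<eta> p v"

definition lee_deriv2 ::
    "('a, 'e::euclidean_space) manifold \<Rightarrow> ('a, 'e) form1 \<Rightarrow> ('a, 'e) form2 \<Rightarrow>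
     'a \<Rightarrow> ('a, 'e) tvec \<Rightarrow> ('a, 'e) tvec \<Rightarrow> ('a, 'e) tvec \<Rightarrow> real" where
  "lee_deriv2 M \<eta> \<beta> p u v w = ext_deriv2 M \<beta> p u v w - wedge12 \<eta> \<beta> p u v w"

definition conformal_symplectic ::
    "('a, 'e::euclidean_space) manifold \<Rightarrow> ('a, 'e) form1 \<Rightarrow> ('a, 'e) form2 \<Rightarrow> bool" where
  "conformal_symplectic M \<eta> \<omega> \<longleftrightarrow>
     smooth_manifold M \<and> even DIM('e) \<and>
     is_form1 M \<eta> \<and> closed_form1 M \<eta> \<and>
     is_form2 M \<omega> \<and> nondegenerate M \<omega> \<and>
     (\<forall>p\<in>points M. \<forall>u\<in>tangent_space M p. \<forall>v\<in>tangent_space M p. \<forall>w\<in>tangent_space M p.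
        lee_deriv2 M \<eta> \<omega> p u v w = 0)"

text \<open>Since \<open>\<omega>\<close> is non-degenerate, the following condition determines \<open>X\<close> on the points of \<open>M\<close>,
  and such an \<open>X\<close> exists and is smooth.\<close>

definition hamiltonian_vector_field ::
    "('a, 'e::euclidean_space) manifold \<Rightarrow> ('a, 'e) form1 \<Rightarrow> ('a, 'e) form2 \<Rightarrow>
     ('a \<Rightarrow> real) \<Rightarrow> ('a \<Rightarrow> ('a, 'e) tvec) \<Rightarrow> bool" where
  "hamiltonian_vector_field M \<eta> \<omega> H X \<longleftrightarrow> (\<forall>p\<in>points M.
     X p \<in> tangent_space M p \<and>
     (\<forall>v\<in>tangent_space M p. \<omega> p (X p) v = lee_deriv0 M \<eta> H p v))"

definition integral_curve ::
    "('a, 'e::euclidean_space) manifold \<Rightarrow> ('a \<Rightarrow> ('a, 'e) tvec) \<Rightarrow> real set \<Rightarrow>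
     (real \<Rightarrow> 'a) \<Rightarrow> bool" where
  "integral_curve M X I \<gamma> \<longleftrightarrow> open I \<and> is_interval I \<and>
     continuous_map (top_of_set I) (mtop M) \<gamma> \<and>
     (\<forall>t\<in>I. \<forall>c\<in>charts_at M (\<gamma> t).
        ((\<lambda>s. chart_fun c (\<gamma> s)) has_vector_derivative X (\<gamma> t) c) (at t))"

text \<open>The graph of the (possibly only locally defined) flow: the flow of \<open>X\<close> at time \<open>t\<close> is
  defined at \<open>p\<close> and maps \<open>p\<close> to \<open>q\<close>.\<close>

definition flow_maps ::
    "('a, 'e::euclidean_space) manifold \<Rightarrow> ('a \<Rightarrow> ('a, 'e) tvec) \<Rightarrow> real \<Rightarrow>
     'a \<Rightarrow> 'a \<Rightarrow> bool" where
  "flow_maps M X t p q \<longleftrightarrow>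
     (\<exists>I \<gamma>. integral_curve M X I \<gamma> \<and> 0 \<in> I \<and> t \<in> I \<and> \<gamma> 0 = p \<and> \<gamma> t = q)"

definition flow_invariant ::
    "('a, 'e::euclidean_space) manifold \<Rightarrow> ('a \<Rightarrow> ('a, 'e) tvec) \<Rightarrow> 'a set \<Rightarrow> bool" where
  "flow_invariant M X S \<longleftrightarrow> (\<forall>t p q. p \<in> S \<longrightarrow> flow_maps M X t p q \<longrightarrow> q \<in> S)"

definition isotropic ::
    "('a, 'f::euclidean_space) manifold \<Rightarrow> ('a, 'e::euclidean_space) manifold \<Rightarrow>
     ('a, 'e) form2 \<Rightarrow> bool" where
  "isotropic L M \<omega> \<longleftrightarrow> (\<forall>p\<in>points L. \<forall>u\<in>tangent_space L p. \<forall>v\<in>tangent_space L p.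
     pullback2 L M id \<omega> p u v = 0)"

end

theory Submission
  imports Defs
begin

text \<open>
  Let \<open>\<beta>\<close> be the pull-back of the Lee form \<open>\<eta>\<close> to the submanifold \<open>L\<close> and \<open>h\<close> the restriction of \<open>H\<close> to
  \<open>L\<close>. Since \<open>L\<close> is invariant, the Hamiltonian field \<open>X\<close> is tangent to \<open>L\<close>, and since \<open>L\<close> is isotropic,
  \<open>\<omega>(X, v) = 0\<close> for all \<open>v\<close> tangent to \<open>L\<close>. As \<open>\<omega>(X, \<cdot>) = dH - H \<eta>\<close>, this says \<open>dh = h \<beta>\<close>. This linear
  equation makes the zero set of \<open>h\<close> open, and it is closed by continuity; as \<open>L\<close> is connected, \<open>h\<close>
  vanishes everywhere or nowhere. In the second case \<open>\<beta> = d (ln \<bar>h\<bar>)\<close> is exact, which is excluded. This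
  last part is \<open>zero_if_logarithmic_derivative_not_exact\<close>.

  The tangency of \<open>X\<close> uses the flow, and so the existence of integral curves
  (\<open>integral_curve_of_dual_field_exists\<close>). In a chart, \<open>X\<close> is the solution of a linear system with
  smooth coefficients which is injective because \<open>\<omega>\<close> is non-degenerate; such a solution is locally
  Lipschitz (\<open>solution_of_linear_system_lipschitz\<close>), and Picard's theorem applies
  (\<open>picard_local\<close>). By invariance the integral curve stays in \<open>L\<close>. That its velocity is tangent
  to \<open>L\<close> is a statement about immersions of Euclidean spaces and continuous curves in their
  source (\<open>velocity_in_range_of_derivative\<close>).
\<close>

section \<open>Calculus of continuously differentiable functions\<close>

lemma frechet_eqI:
  "(f has_derivative f') (at x) \<Longrightarrow> frechet_derivative f (at x) = f'"
  using frechet_derivative_at by metis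

lemma Ck_on_SucD:
  assumes "Ck_on (Suc k) S f" "x \<in> S"
  shows "(f has_derivative frechet_derivative f (at x)) (at x)"
  using assms by (simp add: frechet_derivative_works)

text \<open>The set has to be open because derivatives at its points also see the values nearby.\<close>

lemma Ck_on_cong:
  assumes "open S" "\<And>x. x \<in> S \<Longrightarrow> f x = g x" "Ck_on k S f"
  shows "Ck_on k S g"
  using assms(2,3)
proof (induction k arbitrary: f g)
  case 0
  then show ?case using continuous_on_cong by force
next
  case (Suc k)
  have f: "(f has_derivative frechet_derivative f (at x)) (at x)" if "x \<in> S" for x
    using Ck_on_SucD[OF Suc.prems(2) that] .
  have d: "(g has_derivative frechet_derivative f (at x)) (at x)" if "x \<in> S" for x
    by (rule has_derivative_transform_within_open[OF f[OF that] assms(1) that Suc.prems(1)])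
  have "Ck_on k S (\<lambda>x. frechet_derivative g (at x) v)" for v
    by (rule Suc.IH[of "\<lambda>x. frechet_derivative f (at x) v"])
      (use Suc.prems(2) in \<open>simp_all add: frechet_eqI[OF d]\<close>)
  then show ?case using d by (simp, blast intro: differentiableI)
qed

lemma Ck_on_local:
  assumes "\<And>x. x \<in> S \<Longrightarrow> \<exists>T. open T \<and> x \<in> T \<and> Ck_on k T f"
  shows "Ck_on k S f"
  using assms
proof (induction k arbitrary: f)
  case 0
  then have "\<And>x. x \<in> S \<Longrightarrow> isCont f x"
    by (metis Ck_on.simps(1) continuous_on_eq_continuous_at)
  then show ?case by (simp add: continuous_at_imp_continuous_on)
next
  case (Suc k)
  have "f differentiable at x" if "x \<in> S" for x
    using Suc.prems[OF that] by auto
  moreover have "Ck_on k S (\<lambda>x. frechet_derivative f (at x) v)" for v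
    using Suc.prems by (intro Suc.IH) (metis Ck_on.simps(2))
  ultimately show ?case by simp
qed

lemma Ck_on_lower: "Ck_on (Suc k) S f \<Longrightarrow> Ck_on k S f"
proof (induction k arbitrary: f)
  case 0
  then show ?case
    by (simp add: continuous_at_imp_continuous_on differentiable_imp_continuous_within)
next
  case (Suc k)
  then show ?case using Ck_on.simps(2)[of "Suc k" S f] Ck_on.simps(2)[of k S f] by blast
qed

text \<open>Lets explicit derivatives take the place of \<^const>\<open>frechet_derivative\<close>, a chosen value
  that is only known where the function is differentiable.\<close>

lemma Ck_on_Suc_I:
  assumes "open S" "\<And>x. x \<in> S \<Longrightarrow> (f has_derivative f' x) (at x)"
    "\<And>v. Ck_on k S (\<lambda>x. f' x v)"
  shows "Ck_on (Suc k) S f"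
proof -
  have "Ck_on k S (\<lambda>x. frechet_derivative f (at x) v)" for v
    by (rule Ck_on_cong[OF assms(1) _ assms(3)[of v]]) (simp add: frechet_eqI[OF assms(2)])
  then show ?thesis using assms(2) by (simp, blast intro: differentiableI)
qed

lemma Ck_on_const: "Ck_on k S (\<lambda>x. c)"
  by (induction k arbitrary: c) simp_all

lemma Ck_on_add:
  assumes "open S" "Ck_on k S f" "Ck_on k S g"
  shows "Ck_on k S (\<lambda>x. f x + g x)"
  using assms(2,3)
proof (induction k arbitrary: f g)
  case 0
  then show ?case by (auto intro: continuous_intros)
next
  case (Suc k)
  show ?case
    by (rule Ck_on_Suc_I[OF assms(1) has_derivative_add[OF Ck_on_SucD[OF Suc.prems(1)] Ck_on_SucD[OF Suc.prems(2)]]])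
      (use Suc in auto)
qed

lemma Ck_on_sum:
  assumes "open S" "\<And>i. i \<in> A \<Longrightarrow> Ck_on k S (f i)"
  shows "Ck_on k S (\<lambda>x. \<Sum>i\<in>A. f i x)"
proof (cases "finite A")
  case True
  then show ?thesis using assms(2)
    by (induction A) (auto intro: Ck_on_const Ck_on_add[OF assms(1)])
qed (simp add: Ck_on_const)

lemma Ck_on_bounded_linear:
  assumes "open S" "bounded_linear h" "Ck_on k S f"
  shows "Ck_on k S (\<lambda>x. h (f x))"
  using assms(3)
proof (induction k arbitrary: f)
  case 0
  then show ?case using assms(2) by (simp add: bounded_linear.continuous_on)
next
  case (Suc k)
  show ?case
    by (rule Ck_on_Suc_I[OF assms(1) bounded_linear.has_derivative[OF assms(2) Ck_on_SucD[OF Suc.prems]]],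
        assumption, rule Suc.IH) (use Suc.prems in auto)
qed

lemma Ck_on_scaleR:
  assumes "open S" "Ck_on k S f" "Ck_on k S g"
  shows "Ck_on k S (\<lambda>x. f x *\<^sub>R g x)"
  using assms(2,3)
proof (induction k arbitrary: f g)
  case 0
  then show ?case by (auto intro: continuous_intros)
next
  case (Suc k)
  show ?case
    by (rule Ck_on_Suc_I[OF assms(1) has_derivative_scaleR[OF Ck_on_SucD[OF Suc.prems(1)] Ck_on_SucD[OF Suc.prems(2)]]],
        assumption, assumption, intro Ck_on_add[OF assms(1)] Suc.IH)
      (use Suc.prems Ck_on_lower[OF Suc.prems(1)] Ck_on_lower[OF Suc.prems(2)] in auto)
qed

text \<open>Reduces a derivative in an arbitrary direction to the finitely many directions of a basis, for
  regularity as well as for estimates.\<close>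

lemma linear_eq_sum_Basis:
  fixes f :: "'e::euclidean_space \<Rightarrow> 'b::real_vector"
  assumes "linear f"
  shows "f u = (\<Sum>b\<in>Basis. (u \<bullet> b) *\<^sub>R f b)"
proof -
  have "f u = f (\<Sum>b\<in>Basis. (u \<bullet> b) *\<^sub>R b)" by (simp add: euclidean_representation)
  also have "\<dots> = (\<Sum>b\<in>Basis. (u \<bullet> b) *\<^sub>R f b)"
    by (simp add: linear_sum[OF assms] linear_scale[OF assms])
  finally show ?thesis .
qed

text \<open>By the chain rule and the expansion in a basis, a directional derivative of \<open>g \<circ> f\<close> is a sum of
  products of derivatives of \<open>f\<close> with compositions \<open>\<partial>g \<circ> f\<close>, and the induction hypothesis covers
  these compositions.\<close>

lemma Ck_on_compose:
  fixes f :: "'e::euclidean_space \<Rightarrow> 'f::euclidean_space"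
  assumes "open S" "f ` S \<subseteq> T" "Ck_on k S f" "Ck_on k T g"
  shows "Ck_on k S (g \<circ> f)"
  using assms(3,4)
proof (induction k arbitrary: g)
  case 0
  then show ?case using assms(2) by (simp only: Ck_on.simps) (rule continuous_on_compose, auto intro: continuous_on_subset)
next
  case (Suc k)
  let ?Df = "\<lambda>x. frechet_derivative f (at x)" and ?Dg = "\<lambda>y. frechet_derivative g (at y)"
  have d: "(g \<circ> f has_derivative (\<lambda>v. \<Sum>b\<in>Basis. (?Df x v \<bullet> b) *\<^sub>R ?Dg (f x) b)) (at x)"
    if "x \<in> S" for x
  proof -
    have g: "(g has_derivative ?Dg (f x)) (at (f x))"
      using Ck_on_SucD[OF Suc.prems(2)] that assms(2) by auto
    have "(g \<circ> f has_derivative ?Dg (f x) \<circ> ?Df x) (at x)"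
      by (rule diff_chain_at[OF Ck_on_SucD[OF Suc.prems(1) that] g])
    moreover have "(?Dg (f x) \<circ> ?Df x) = (\<lambda>v. \<Sum>b\<in>Basis. (?Df x v \<bullet> b) *\<^sub>R ?Dg (f x) b)"
      by (rule ext, unfold o_apply, rule linear_eq_sum_Basis[OF has_derivative_linear[OF g]])
    ultimately show ?thesis by simp
  qed
  have "Ck_on k S (\<lambda>x. \<Sum>b\<in>Basis. (?Df x v \<bullet> b) *\<^sub>R ?Dg (f x) b)" for v
  proof (intro Ck_on_sum[OF assms(1)] Ck_on_scaleR[OF assms(1)])
    fix b :: 'f
    show "Ck_on k S (\<lambda>x. ?Df x v \<bullet> b)"
      using Suc.prems(1) by (intro Ck_on_bounded_linear[OF assms(1) bounded_linear_inner_left]) auto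
    have "Ck_on k S ((\<lambda>y. ?Dg y b) \<circ> f)"
      using Suc.prems(2) by (intro Suc.IH[OF Ck_on_lower[OF Suc.prems(1)]]) auto
    then show "Ck_on k S (\<lambda>x. ?Dg (f x) b)" by (simp add: o_def)
  qed
  with d show ?case by (rule Ck_on_Suc_I[OF assms(1)])
qed

lemma Ck_on_inverse: "Ck_on k (- {0}) (inverse :: real \<Rightarrow> real)"
proof (induction k)
  case 0
  then show ?case by (auto intro!: continuous_intros)
next
  case (Suc k)
  have "Ck_on k (-{0}) (\<lambda>x::real. (inverse x *\<^sub>R inverse x) *\<^sub>R (- v))" for v :: real
    by (intro Ck_on_scaleR Suc Ck_on_const) auto
  then show ?case
    by (intro Ck_on_Suc_I[where f' = "\<lambda>x v. (inverse x *\<^sub>R inverse x) *\<^sub>R (- v)"])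
      (auto intro!: derivative_eq_intros)
qed

text \<open>Away from 0, \<open>ln \<bar>h\<bar>\<close> has derivative \<open>dh / h\<close> whatever the sign of \<open>h\<close>; the absolute value
  avoids having to know that sign.\<close>

lemma ln_abs_has_derivative:
  assumes "x \<noteq> (0::real)"
  shows "((\<lambda>x. ln \<bar>x\<bar>) has_derivative (\<lambda>v. inverse x * v)) (at x)"
proof (cases "x > 0")
  case True
  have "(ln has_derivative (\<lambda>v. inverse x * v)) (at x)"
    using True by (auto intro!: derivative_eq_intros simp: field_simps)
  then show ?thesis
    by (rule has_derivative_transform_within_open[of _ _ _ _ "{0<..}"]) (use True in auto)
next
  case False
  have "((\<lambda>x. ln (- x)) has_derivative (\<lambda>v. inverse x * v)) (at x)"
    using False assms by (auto intro!: derivative_eq_intros simp: field_simps)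
  then show ?thesis
    by (rule has_derivative_transform_within_open[of _ _ _ _ "{..<0}"]) (use False assms in auto)
qed

lemma Ck_on_ln_abs: "Ck_on k (- {0}) (\<lambda>x::real. ln \<bar>x\<bar>)"
proof (cases k)
  case 0
  then show ?thesis by (auto intro!: continuous_intros)
next
  case (Suc m)
  have "Ck_on m (-{0}) (\<lambda>x::real. inverse x *\<^sub>R v)" for v :: real
    by (intro Ck_on_scaleR Ck_on_inverse Ck_on_const) auto
  then show ?thesis unfolding Suc
    by (intro Ck_on_Suc_I[OF _ ln_abs_has_derivative]) auto
qed

section \<open>Charts and changes of charts\<close>

lemma
  assumes "is_chart T c"
  shows chart_dom_open: "openin T (chart_dom c)"
    and chart_dom_points: "chart_dom c \<subseteq> topspace T"
    and chart_inv_fun: "p \<in> chart_dom c \<Longrightarrow> chart_inv c (chart_fun c p) = p"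
    and chart_fun_inv: "x \<in> chart_img c \<Longrightarrow> chart_fun c (chart_inv c x) = x"
    and chart_inv_dom: "x \<in> chart_img c \<Longrightarrow> chart_inv c x \<in> chart_dom c"
    and chart_img_open: "open (chart_img c)"
    and chart_continuous: "continuous_map (subtopology T (chart_dom c)) euclidean (chart_fun c)"
    and chart_inv_continuous: "continuous_map (top_of_set (chart_img c)) T (chart_inv c)"
    and chart_image_open: "openin T U \<Longrightarrow> open (chart_fun c ` (chart_dom c \<inter> U))"
proof -
  show o: "openin T (chart_dom c)" and oi: "open (chart_img c)"
    using assms by (auto simp: is_chart_def)
  show sub: "chart_dom c \<subseteq> topspace T" using o by (rule openin_subset)
  have ts: "topspace (subtopology T (chart_dom c)) = chart_dom c" using sub by auto
  have h: "homeomorphic_map (subtopology T (chart_dom c)) (top_of_set (chart_img c)) (chart_fun c)"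
    using assms by (auto simp: is_chart_def)
  have inj: "inj_on (chart_fun c) (chart_dom c)"
    using homeomorphic_imp_injective_map[OF h] by (simp only: ts)
  show i: "chart_inv c (chart_fun c p) = p" if "p \<in> chart_dom c" for p
    using inj that by (simp add: chart_inv_def)
  show "chart_fun c (chart_inv c x) = x" if "x \<in> chart_img c" for x
    using that by (auto simp: chart_img_def i)
  show d: "chart_inv c x \<in> chart_dom c" if "x \<in> chart_img c" for x
    using that by (auto simp: chart_img_def i)
  show "continuous_map (subtopology T (chart_dom c)) euclidean (chart_fun c)"
    using homeomorphic_imp_continuous_map[OF h] continuous_map_into_fulltopology by blast
  obtain g where g: "homeomorphic_maps (subtopology T (chart_dom c)) (top_of_set (chart_img c)) (chart_fun c) g"
    using h homeomorphic_map_maps by blast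
  have "continuous_map (top_of_set (chart_img c)) (subtopology T (chart_dom c)) (chart_inv c)"
  proof (rule continuous_map_eq)
    show "continuous_map (top_of_set (chart_img c)) (subtopology T (chart_dom c)) g"
      using g by (simp add: homeomorphic_maps_def)
    show "g x = chart_inv c x" if "x \<in> topspace (top_of_set (chart_img c))" for x
      using that g ts i by (auto simp: homeomorphic_maps_def chart_img_def)
  qed
  then show "continuous_map (top_of_set (chart_img c)) T (chart_inv c)"
    using continuous_map_into_fulltopology by blast
  show "open (chart_fun c ` (chart_dom c \<inter> U))" if "openin T U"
  proof -
    have "openin (subtopology T (chart_dom c)) (chart_dom c \<inter> U)"
      using that by (simp add: openin_subtopology_Int2 o)
    then have "openin (top_of_set (chart_img c)) (chart_fun c ` (chart_dom c \<inter> U))"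
      using homeomorphic_map_openness[OF h] ts by blast
    then show ?thesis using oi openin_open_eq by blast
  qed
qed

lemma chart_fun_in_img: "p \<in> chart_dom c \<Longrightarrow> chart_fun c p \<in> chart_img c"
  by (simp add: chart_img_def)

lemma charts_atD:
  assumes "smooth_manifold M" "c \<in> charts_at M p"
  shows "is_chart (mtop M) c" "c \<in> atlas M" "p \<in> chart_dom c"
  using assms by (auto simp: smooth_manifold_def charts_at_def)

lemma some_chart_in:
  assumes "smooth_manifold M" "p \<in> points M"
  shows "some_chart M p \<in> charts_at M p"
proof -
  have "p \<in> (\<Union>c\<in>atlas M. chart_dom c)" using assms by (simp add: smooth_manifold_def)
  then have "\<exists>c. c \<in> charts_at M p" by (auto simp: charts_at_def)
  then show ?thesis unfolding some_chart_def by (rule someI_ex)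
qed

text \<open>The two charts may belong to different manifolds on the same point type. For two charts of one
  manifold this is the derivative of a transition map; for a chart \<open>c\<close> of a submanifold and a chart
  \<open>d\<close> of the ambient manifold it is the derivative of the inclusion.\<close>

abbreviation transition_deriv where
  "transition_deriv c d p \<equiv> frechet_derivative (chart_fun d \<circ> chart_inv c) (at (chart_fun c p))"

text \<open>Through this lemma, statements about an inclusion of \<open>L\<close> into \<open>M\<close> apply to \<open>L = M\<close>, where they
  are about transition maps.\<close>

lemma smooth_map_id: "smooth_manifold M \<Longrightarrow> smooth_map M M id"
  by (auto simp: smooth_map_def smooth_manifold_def)

lemma overlap_open:
  assumes "smooth_map L M id" "smooth_manifold L" "smooth_manifold M" "c \<in> atlas L" "d \<in> atlas M"
  shows "open (chart_fun c ` (chart_dom c \<inter> chart_dom d))"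
proof -
  have c: "is_chart (mtop L) c" and d: "is_chart (mtop M) d"
    using assms by (auto simp: smooth_manifold_def)
  have "openin (mtop L) {p \<in> points L. id p \<in> chart_dom d}"
    using assms(1) chart_dom_open[OF d] unfolding smooth_map_def
    by (metis openin_continuous_map_preimage)
  then have "open (chart_fun c ` (chart_dom c \<inter> {p \<in> points L. id p \<in> chart_dom d}))"
    by (rule chart_image_open[OF c])
  also have "chart_dom c \<inter> {p \<in> points L. id p \<in> chart_dom d} = chart_dom c \<inter> chart_dom d"
    using chart_dom_points[OF c] by auto
  finally show ?thesis .
qed

lemma overlap_smooth:
  assumes "smooth_map L M id" "c \<in> atlas L" "d \<in> atlas M"
  shows "Ck_on k (chart_fun c ` (chart_dom c \<inter> chart_dom d)) (chart_fun d \<circ> chart_inv c)"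
  using assms by (simp add: smooth_map_def smooth_on_def)

lemma transition_has_derivative:
  assumes "smooth_map L M id" "smooth_manifold L" "smooth_manifold M"
    "c \<in> charts_at L p" "d \<in> charts_at M p"
  shows "(chart_fun d \<circ> chart_inv c has_derivative transition_deriv c d p) (at (chart_fun c p))"
  using overlap_smooth[of L M c d 1] assms
  by (intro Ck_on_SucD[where k = 0 and S = "chart_fun c ` (chart_dom c \<inter> chart_dom d)"])
    (auto simp: charts_at_def)

text \<open>The chain rule, localised to the overlap of the two charts, where \<open>F \<circ> chart_inv c\<close> is
  \<open>(F \<circ> chart_inv d) \<circ> (chart_fun d \<circ> chart_inv c)\<close>. It is stated for any normed target, so
  that \<open>F\<close> can be a real function as well as another chart.\<close>

lemma chart_change_has_derivative:
  fixes F :: "'a \<Rightarrow> 'b::real_normed_vector"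
  assumes "smooth_map L M id" "smooth_manifold L" "smooth_manifold M"
    "c \<in> charts_at L p" "d \<in> charts_at M p"
    and F: "(F \<circ> chart_inv d has_derivative F') (at (chart_fun d p))"
  shows "(F \<circ> chart_inv c has_derivative F' \<circ> transition_deriv c d p) (at (chart_fun c p))"
proof -
  note c = charts_atD[OF assms(2,4)] and d = charts_atD[OF assms(3,5)]
  have "((F \<circ> chart_inv d) \<circ> (chart_fun d \<circ> chart_inv c) has_derivative F' \<circ> transition_deriv c d p)
      (at (chart_fun c p))"
    using F by (intro diff_chain_at transition_has_derivative[OF assms(1-5)])
      (simp add: chart_inv_fun[OF c(1) c(3)])
  then show ?thesis
    by (rule has_derivative_transform_within_open[OF _ overlap_open[OF assms(1-3) c(2) d(2)]])
      (use c(3) d(3) in \<open>auto simp: chart_inv_fun[OF c(1)] chart_inv_fun[OF d(1)]\<close>)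
qed

text \<open>The cocycle rule, the chain rule for \<open>F = chart_fun e\<close>.\<close>

lemma transition_deriv_comp:
  assumes "smooth_map K L id" "smooth_map L M id"
    "smooth_manifold K" "smooth_manifold L" "smooth_manifold M"
    "c \<in> charts_at K p" "d \<in> charts_at L p" "e \<in> charts_at M p"
  shows "transition_deriv c e p u = transition_deriv d e p (transition_deriv c d p u)"
  using frechet_eqI[OF chart_change_has_derivative[OF assms(1,3,4,6,7)
        transition_has_derivative[OF assms(2,4,5,7,8)]]] by simp

lemma transition_deriv_self:
  assumes "smooth_manifold M" "c \<in> charts_at M p"
  shows "transition_deriv c c p u = u"
proof -
  note c = charts_atD[OF assms]
  have "((\<lambda>x. x) has_derivative (\<lambda>x. x)) (at (chart_fun c p))" by simp
  then have "(chart_fun c \<circ> chart_inv c has_derivative (\<lambda>x. x)) (at (chart_fun c p))"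
    by (rule has_derivative_transform_within_open[OF _ chart_img_open[OF c(1)]])
      (use c(3) in \<open>auto simp: chart_fun_inv[OF c(1)] chart_fun_in_img\<close>)
  then show ?thesis by (simp add: frechet_eqI)
qed

lemma coord_vector_apply:
  assumes "smooth_manifold M" "c \<in> charts_at M p"
  shows "coord_vector M c p u c = u"
  using assms by (simp add: coord_vector_def transition_deriv_self)

lemma coord_vector_in_tangent_space:
  assumes "smooth_manifold M" "c \<in> charts_at M p"
  shows "coord_vector M c p u \<in> tangent_space M p"
proof -
  have *: "coord_vector M c p u e = transition_deriv d e p (coord_vector M c p u d)"
    if "d \<in> charts_at M p" "e \<in> charts_at M p" for d e
    using transition_deriv_comp[OF smooth_map_id smooth_map_id, OF assms(1,1,1,1,1,2) that] that
    by (simp only: coord_vector_def if_True)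
  show ?thesis unfolding tangent_space_def mem_Collect_eq
    by (intro conjI allI impI ballI *) (simp_all add: coord_vector_def)
qed

lemma tangent_vector_change_chart:
  assumes "v \<in> tangent_space M p" "c \<in> charts_at M p" "d \<in> charts_at M p"
  shows "v d = transition_deriv c d p (v c)"
  using assms unfolding tangent_space_def by blast

text \<open>A tangent vector is determined by its expression in a single chart, so equalities of tangent
  vectors can be checked there.\<close>

lemma tangent_vector_eq_coord_vector:
  assumes "v \<in> tangent_space M p" "c \<in> charts_at M p"
  shows "v = coord_vector M c p (v c)"
proof
  fix d
  show "v d = coord_vector M c p (v c) d"
  proof (cases "d \<in> charts_at M p")
    case True
    show ?thesis
      using tangent_vector_change_chart[OF assms True] True by (simp only: coord_vector_def if_True)
  next
    case False
    then have "v d = 0" using assms(1) unfolding tangent_space_def by blast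
    then show ?thesis using False by (simp add: coord_vector_def)
  qed
qed

lemma linear_transition_deriv:
  assumes "smooth_manifold M" "c \<in> charts_at M p" "d \<in> charts_at M p"
  shows "linear (transition_deriv c d p)"
  using transition_has_derivative[OF smooth_map_id, OF assms(1,1,1,2,3)] by (rule has_derivative_linear)

lemma coord_vector_linear:
  assumes "smooth_manifold M" "c \<in> charts_at M p"
  shows "coord_vector M c p (a *\<^sub>R u + b *\<^sub>R w) =
    (\<lambda>d. a *\<^sub>R coord_vector M c p u d + b *\<^sub>R coord_vector M c p w d)"
  using linear_transition_deriv[OF assms]
  by (auto simp: coord_vector_def linear_add linear_scale)

lemma linear_on_tangent_coord:
  assumes "smooth_manifold M" "c \<in> charts_at M p" "linear_on_tangent M p l"
  shows "linear (\<lambda>u. l (coord_vector M c p u))"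
proof -
  have *: "l (coord_vector M c p (a *\<^sub>R u + b *\<^sub>R w)) = a * l (coord_vector M c p u) + b * l (coord_vector M c p w)"
    for a b u w
    unfolding coord_vector_linear[OF assms(1,2)]
    using assms(3) coord_vector_in_tangent_space[OF assms(1,2)] by (simp add: linear_on_tangent_def)
  show ?thesis
    using *[of 1 _ 1] *[of _ _ 0] by (intro linearI) simp_all
qed

lemma smooth_fun_has_derivative:
  assumes "smooth_fun M F" "c \<in> charts_at M p"
  shows "(F \<circ> chart_inv c has_derivative frechet_derivative (F \<circ> chart_inv c) (at (chart_fun c p)))
    (at (chart_fun c p))"
proof (rule Ck_on_SucD[where k = 0])
  show "Ck_on (Suc 0) (chart_img c) (F \<circ> chart_inv c)"
    using assms by (simp add: smooth_fun_def smooth_on_def charts_at_def del: Ck_on.simps)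
qed (use assms in \<open>auto simp: charts_at_def chart_fun_in_img\<close>)

text \<open>The differential is defined through a chosen chart; the chain rule makes every chart as good.\<close>

lemma differential_in_chart:
  assumes "smooth_manifold M" "smooth_fun M F" "p \<in> points M" "c \<in> charts_at M p"
    "v \<in> tangent_space M p"
  shows "differential M F p v = frechet_derivative (F \<circ> chart_inv c) (at (chart_fun c p)) (v c)"
proof -
  let ?d = "some_chart M p"
  note d = some_chart_in[OF assms(1,3)]
  have "(F \<circ> chart_inv c has_derivative
      frechet_derivative (F \<circ> chart_inv ?d) (at (chart_fun ?d p)) \<circ> transition_deriv c ?d p) (at (chart_fun c p))"
    by (rule chart_change_has_derivative[OF smooth_map_id, OF assms(1,1,1,4) d
          smooth_fun_has_derivative[OF assms(2) d]])
  moreover have "v ?d = transition_deriv c ?d p (v c)"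
    by (rule tangent_vector_change_chart[OF assms(5,4) d])
  ultimately show ?thesis by (simp add: differential_def Let_def frechet_eqI)
qed

lemma tangent_map_in_charts:
  assumes "smooth_map L M id" "smooth_manifold L" "smooth_manifold M" "p \<in> points L"
    "c \<in> charts_at L p" "d \<in> charts_at M p" "v \<in> tangent_space L p"
  shows "tangent_map L M id p v = coord_vector M d p (transition_deriv c d p (v c))"
proof -
  let ?s = "some_chart L p"
  note s = some_chart_in[OF assms(2,4)]
  have v: "v ?s = transition_deriv c ?s p (v c)"
    by (rule tangent_vector_change_chart[OF assms(7,5) s])
  have "transition_deriv ?s e p (v ?s) = transition_deriv d e p (transition_deriv c d p (v c))"
    if "e \<in> charts_at M p" for e
    unfolding v transition_deriv_comp[OF smooth_map_id assms(1), OF assms(2,2,2,3) assms(5) s that, symmetric]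
    by (rule transition_deriv_comp[OF assms(1) smooth_map_id, OF assms(3,2,3,3) assms(5,6) that])
  then show ?thesis
    by (auto simp: tangent_map_def coord_vector_def Let_def)
qed

text \<open>Around each point, the expression in a chart of \<open>L\<close> is the composition of the expression in a
  chart of \<open>M\<close> with the inclusion read in the two charts.\<close>

lemma Ck_on_restrict_chart:
  fixes F :: "'a \<Rightarrow> 'b::real_normed_vector"
  assumes "smooth_map L M id" "smooth_manifold L" "smooth_manifold M" "c \<in> atlas L"
    and F: "\<And>d. d \<in> atlas M \<Longrightarrow> Ck_on k (chart_img d) (F \<circ> chart_inv d)"
  shows "Ck_on k (chart_img c) (F \<circ> chart_inv c)"
proof (rule Ck_on_local)
  have c: "is_chart (mtop L) c" using assms by (simp add: smooth_manifold_def)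
  fix x assume x: "x \<in> chart_img c"
  then have "chart_inv c x \<in> points L" using chart_inv_dom[OF c] chart_dom_points[OF c] by auto
  then have pM: "chart_inv c x \<in> points M"
    using assms(1) by (auto simp: smooth_map_def continuous_map_def)
  define d where "d = some_chart M (chart_inv c x)"
  note d = some_chart_in[OF assms(3) pM, folded d_def]
  note d' = charts_atD[OF assms(3) d]
  let ?S = "chart_fun c ` (chart_dom c \<inter> chart_dom d)"
  have oS: "open ?S" by (rule overlap_open[OF assms(1-4) d'(2)])
  have "Ck_on k ?S ((F \<circ> chart_inv d) \<circ> (chart_fun d \<circ> chart_inv c))"
    by (rule Ck_on_compose[OF oS _ overlap_smooth[OF assms(1,4) d'(2)] F[OF d'(2)]])
      (auto simp: chart_inv_fun[OF c] chart_fun_in_img)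
  then have "Ck_on k ?S (F \<circ> chart_inv c)"
    by (rule Ck_on_cong[OF oS, rotated]) (auto simp: chart_inv_fun[OF c] chart_inv_fun[OF d'(1)])
  moreover have "x \<in> ?S"
    using d'(3) x chart_inv_dom[OF c x] chart_fun_inv[OF c x] by (metis IntI imageI)
  ultimately show "\<exists>T. open T \<and> x \<in> T \<and> Ck_on k T (F \<circ> chart_inv c)" using oS by blast
qed

lemma smooth_fun_restrict:
  assumes "smooth_map L M id" "smooth_manifold L" "smooth_manifold M" "smooth_fun M F"
  shows "smooth_fun L F"
  using assms(4) by (auto simp: smooth_fun_def smooth_on_def intro: Ck_on_restrict_chart[OF assms(1-3)])

section \<open>Differential equations and curves in Euclidean space\<close>

text \<open>The partial derivatives are bounded on the compact ball, hence so is the operator norm of the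
  derivative, and the mean value inequality applies on the convex ball.\<close>

lemma C1_lipschitz_on_cball:
  fixes f :: "'e::euclidean_space \<Rightarrow> 'b::real_normed_vector"
  assumes "Ck_on 1 U f" "cball x0 r \<subseteq> U"
  shows "\<exists>K\<ge>0. \<forall>x\<in>cball x0 r. \<forall>y\<in>cball x0 r. norm (f x - f y) \<le> K * norm (x - y)"
proof -
  let ?D = "\<lambda>x. frechet_derivative f (at x)"
  have der: "(f has_derivative ?D x) (at x)" if "x \<in> cball x0 r" for x
    using Ck_on_SucD[of 0 U f x] assms that by auto
  have "\<exists>c. \<forall>x\<in>cball x0 r. norm (?D x b) \<le> c" for b
  proof -
    have "continuous_on (cball x0 r) (\<lambda>x. ?D x b)"
      using assms by (auto intro: continuous_on_subset)
    then have "bounded ((\<lambda>x. ?D x b) ` cball x0 r)"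
      by (intro compact_imp_bounded compact_continuous_image) auto
    then show ?thesis by (auto simp: bounded_iff)
  qed
  then obtain c where c: "\<And>b x. x \<in> cball x0 r \<Longrightarrow> norm (?D x b) \<le> c b" by metis
  define K where "K = (\<Sum>b\<in>Basis. \<bar>c b\<bar>)"
  have "onorm (?D x) \<le> K" if x: "x \<in> cball x0 r" for x
  proof (rule onorm_le)
    fix v
    have "norm (?D x v) = norm (\<Sum>b\<in>Basis. (v \<bullet> b) *\<^sub>R ?D x b)"
      by (rule arg_cong[of _ _ norm], rule linear_eq_sum_Basis[OF has_derivative_linear[OF der[OF x]]])
    also have "\<dots> \<le> (\<Sum>b\<in>Basis. norm ((v \<bullet> b) *\<^sub>R ?D x b))" by (rule norm_sum)
    also have "\<dots> \<le> (\<Sum>b\<in>Basis. \<bar>c b\<bar> * norm v)"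
    proof (rule sum_mono)
      fix b :: 'e assume b: "b \<in> Basis"
      have "norm ((v \<bullet> b) *\<^sub>R ?D x b) = \<bar>v \<bullet> b\<bar> * norm (?D x b)" by simp
      also have "\<dots> \<le> norm v * \<bar>c b\<bar>"
        using Basis_le_norm[OF b, of v] order_trans[OF c[OF x, of b] abs_ge_self] by (intro mult_mono) auto
      finally show "norm ((v \<bullet> b) *\<^sub>R ?D x b) \<le> \<bar>c b\<bar> * norm v" by (simp add: mult.commute)
    qed
    finally show "norm (?D x v) \<le> K * norm v" by (simp add: K_def sum_distrib_right)
  qed
  moreover have "K \<ge> 0" by (simp add: K_def sum_nonneg)
  ultimately show ?thesis
    using differentiable_bound[OF convex_cball has_derivative_at_withinI[OF der], of x0 r K] by blast
qed

text \<open>The Lipschitz bound for the solution is read off the system itself, without inverting \<open>B x\<close>: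
  injectivity at \<open>x0\<close> gives \<open>\<beta> \<parallel>v\<parallel> \<le> \<parallel>B x0 v\<parallel>\<close>, half of which survives on a small ball, and
  \<open>B x (X x - X y) = (b x - b y) - (B x - B y) (X y)\<close>.\<close>

lemma solution_of_linear_system_lipschitz:
  fixes B :: "'e::euclidean_space \<Rightarrow> 'e \<Rightarrow> 'e" and X b :: "'e \<Rightarrow> 'e"
  assumes "open U" "x0 \<in> U"
    and lin: "\<And>x. x \<in> U \<Longrightarrow> linear (B x)"
    and B1: "\<And>v. Ck_on 1 U (\<lambda>x. B x v)" and b1: "Ck_on 1 U b"
    and eq: "\<And>x. x \<in> U \<Longrightarrow> B x (X x) = b x" and inj: "inj (B x0)"
  obtains r K where "r > 0" "cball x0 r \<subseteq> U" "K \<ge> 0"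
    "\<And>x y. x \<in> cball x0 r \<Longrightarrow> y \<in> cball x0 r \<Longrightarrow> norm (X x - X y) \<le> K * norm (x - y)"
proof -
  obtain s where s: "s > 0" "cball x0 s \<subseteq> U" using assms(1,2) open_contains_cball by blast
  obtain k where k: "\<And>v. k v \<ge> 0"
    "\<And>v x y. x \<in> cball x0 s \<Longrightarrow> y \<in> cball x0 s \<Longrightarrow> norm (B x v - B y v) \<le> k v * norm (x - y)"
    using C1_lipschitz_on_cball[OF B1 s(2)] by metis
  define kB where "kB = (\<Sum>i\<in>Basis. k i)"
  have kB: "norm (B x v - B y v) \<le> kB * norm (x - y) * norm v"
    if x: "x \<in> cball x0 s" and y: "y \<in> cball x0 s" for x y v
  proof -
    have "B x v - B y v = (\<Sum>i\<in>Basis. (v \<bullet> i) *\<^sub>R (B x i - B y i))"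
      unfolding linear_eq_sum_Basis[OF lin[OF subsetD[OF s(2) x]], of v]
        linear_eq_sum_Basis[OF lin[OF subsetD[OF s(2) y]], of v]
      by (simp add: sum_subtractf scaleR_diff_right)
    also have "norm \<dots> \<le> (\<Sum>i\<in>Basis. norm ((v \<bullet> i) *\<^sub>R (B x i - B y i)))" by (rule norm_sum)
    also have "\<dots> \<le> (\<Sum>i\<in>Basis. norm v * (k i * norm (x - y)))"
    proof (rule sum_mono)
      fix i :: 'e assume i: "i \<in> Basis"
      show "norm ((v \<bullet> i) *\<^sub>R (B x i - B y i)) \<le> norm v * (k i * norm (x - y))"
        using Basis_le_norm[OF i, of v] k(2)[OF x y, of i] by (auto intro!: mult_mono)
    qed
    also have "\<dots> = kB * norm (x - y) * norm v"
      by (simp add: kB_def sum_distrib_left sum_distrib_right mult_ac)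
    finally show ?thesis .
  qed
  have kB0: "kB \<ge> 0" using k(1) by (simp add: kB_def sum_nonneg)
  obtain kb where kb: "kb \<ge> 0"
    "\<And>x y. x \<in> cball x0 s \<Longrightarrow> y \<in> cball x0 s \<Longrightarrow> norm (b x - b y) \<le> kb * norm (x - y)"
    using C1_lipschitz_on_cball[OF b1 s(2)] by blast
  obtain \<beta> where \<beta>: "\<beta> > 0" "\<And>v. \<beta> * norm v \<le> norm (B x0 v)"
    using linear_inj_bounded_below_pos[OF lin[OF assms(2)] inj] by blast
  \<comment> \<open>On this ball \<open>B x\<close> differs from \<open>B x0\<close> by at most \<open>\<beta> / 2\<close> in operator norm.\<close>
  define r where "r = min s (\<beta> / (2 * (kB + 1)))"
  have r: "r > 0" "r \<le> s" "kB * r \<le> \<beta> / 2"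
  proof -
    show "r > 0" "r \<le> s" using s(1) \<beta>(1) kB0 by (auto simp: r_def)
    have "kB * r \<le> (kB + 1) * (\<beta> / (2 * (kB + 1)))"
      using kB0 \<beta>(1) s(1) by (intro mult_mono) (auto simp: r_def)
    also have "\<dots> = \<beta> / 2" using kB0 by (simp add: field_simps)
    finally show "kB * r \<le> \<beta> / 2" .
  qed
  have sub: "cball x0 r \<subseteq> cball x0 s" using r(2) by auto
  have below: "\<beta> / 2 * norm v \<le> norm (B x v)" if x: "x \<in> cball x0 r" for x v
  proof -
    have "norm (B x0 v - B x v) \<le> kB * norm (x0 - x) * norm v"
      using x sub s(1) by (intro kB) auto
    also have "\<dots> \<le> kB * r * norm v"
      using x kB0 by (intro mult_right_mono mult_left_mono) (auto simp: dist_norm)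
    also have "\<dots> \<le> \<beta> / 2 * norm v" using r(3) by (intro mult_right_mono) auto
    finally show ?thesis
      using \<beta>(2)[of v] norm_triangle_ineq2[of "B x0 v" "B x v"] by (simp add: field_simps)
  qed
  \<comment> \<open>On the ball \<open>b\<close> is bounded by the term in parentheses, and \<open>B y\<close> shrinks norms by at most the factor \<open>\<beta> / 2\<close>.\<close>
  define m where "m = (2 / \<beta>) * (norm (b x0) + kb * s)"
  have m0: "m \<ge> 0" using \<beta>(1) kb(1) s(1) by (simp add: m_def)
  have Xm: "norm (X y) \<le> m" if y: "y \<in> cball x0 r" for y
  proof -
    have yU: "y \<in> U" using y sub s(2) by auto
    have "\<beta> / 2 * norm (X y) \<le> norm (b y)" using below[OF y, of "X y"] eq[OF yU] by simp
    also have "norm (b y) \<le> norm (b x0) + norm (b y - b x0)" by (metis add.commute norm_triangle_sub)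
    also have "norm (b y - b x0) \<le> kb * norm (y - x0)" using y sub s(1) by (intro kb(2)) auto
    also have "\<dots> \<le> kb * s" using y sub kb(1) by (intro mult_left_mono) (auto simp: dist_norm norm_minus_commute)
    finally show ?thesis using \<beta>(1) by (simp add: m_def field_simps)
  qed
  define K where "K = (2 / \<beta>) * (kb + kB * m)"
  show thesis
  proof (rule that[OF r(1)])
    show "cball x0 r \<subseteq> U" using sub s(2) by auto
    show "K \<ge> 0" using \<beta>(1) kb(1) kB0 m0 by (simp add: K_def)
    fix x y assume x: "x \<in> cball x0 r" and y: "y \<in> cball x0 r"
    have xU: "x \<in> U" and yU: "y \<in> U" using x y sub s(2) by auto
    have "\<beta> / 2 * norm (X x - X y) \<le> norm (B x (X x - X y))" by (rule below[OF x])
    also have "B x (X x - X y) = (b x - b y) - (B x (X y) - B y (X y))"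
      using eq[OF xU] eq[OF yU] by (simp add: linear_diff[OF lin[OF xU]])
    also have "norm \<dots> \<le> norm (b x - b y) + norm (B x (X y) - B y (X y))" by (rule norm_triangle_ineq4)
    also have "\<dots> \<le> kb * norm (x - y) + kB * norm (x - y) * norm (X y)"
      using x y sub by (intro add_mono kb(2) kB) auto
    also have "\<dots> \<le> kb * norm (x - y) + kB * norm (x - y) * m"
      using Xm[OF y] kB0 by (intro add_left_mono mult_left_mono) auto
    finally show "norm (X x - X y) \<le> K * norm (x - y)"
      using \<beta>(1) by (simp add: K_def field_simps)
  qed
qed

text \<open>Picard's theorem: solutions are the fixed points of the integral operator, a contraction of the
  space of bounded continuous curves for a short time \<open>T\<close>. Curves are defined on all of \<open>\<real>\<close> and
  kept constant outside \<open>[-T, T]\<close> by the clamp \<open>C\<close>. Integrals start at \<open>-T\<close> and are corrected by their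
  value at 0, which treats positive and negative times alike.\<close>

lemma picard_global_lipschitz:
  fixes G :: "'e::euclidean_space \<Rightarrow> 'e"
  assumes "K \<ge> 0" and lip: "\<And>x y. norm (G x - G y) \<le> K * norm (x - y)"
  obtains T x where "T > 0" "x 0 = x0"
    "\<And>t. t \<in> {-T<..<T} \<Longrightarrow> (x has_vector_derivative G (x t)) (at t)"
proof -
  \<comment> \<open>Two integrals over intervals of length at most \<open>2 * T\<close> give the contraction factor \<open>4 * T * K\<close>.\<close>
  define T where "T = 1 / (4 * (K + 1))"
  have T: "T > 0" "4 * T * K < 1" using assms(1) by (auto simp: T_def field_simps)
  have contG: "continuous_on S G" for S
    by (rule lipschitz_on_continuous_on[of K], rule lipschitz_onI)
      (use assms in \<open>auto simp: dist_norm\<close>)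
  have cont: "continuous_on S (\<lambda>s. G (apply_bcontfun \<phi> s))" for S and \<phi> :: "real \<Rightarrow>\<^sub>C 'e"
    by (rule continuous_on_compose2[OF contG[of UNIV]]) auto
  define J where "J \<phi> t = integral {-T..t} (\<lambda>s. G (apply_bcontfun \<phi> s))" for \<phi> :: "real \<Rightarrow>\<^sub>C 'e" and t
  define C where "C t = max (-T) (min T t)" for t
  have C: "C t \<in> {-T..T}" for t using T(1) by (auto simp: C_def)
  have contJ: "continuous_on {-T..T} (J \<phi>)" for \<phi>
    unfolding J_def by (intro indefinite_integral_continuous_1 integrable_continuous_real cont)
  define \<Phi> where "\<Phi> \<phi> t = x0 + J \<phi> (C t) - J \<phi> 0" for \<phi> t
  have "\<Phi> \<phi> \<in> bcontfun" for \<phi>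
  proof -
    have "continuous_on UNIV (\<lambda>t. J \<phi> (C t))"
      by (rule continuous_on_compose2[OF contJ]) (use C in \<open>auto simp: C_def intro!: continuous_intros\<close>)
    then have "continuous_on UNIV (\<Phi> \<phi>)" unfolding \<Phi>_def by (intro continuous_intros)
    moreover have "bounded ((\<lambda>u. x0 + J \<phi> u - J \<phi> 0) ` {-T..T})"
      by (intro compact_imp_bounded compact_continuous_image continuous_intros contJ) auto
    then have "bounded (range (\<Phi> \<phi>))"
      by (rule bounded_subset) (use C in \<open>auto simp: \<Phi>_def\<close>)
    ultimately show ?thesis by (simp add: bcontfun_def)
  qed
  then have app: "apply_bcontfun (Bcontfun (\<Phi> \<phi>)) = \<Phi> \<phi>" for \<phi>
    by (rule Bcontfun_inverse)
  have Jdist: "norm (J \<phi> t - J \<psi> t) \<le> 2 * T * K * dist \<phi> \<psi>" if t: "t \<in> {-T..T}" for \<phi> \<psi> t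
  proof -
    have "J \<phi> t - J \<psi> t = integral {-T..t} (\<lambda>s. G (apply_bcontfun \<phi> s) - G (apply_bcontfun \<psi> s))"
      unfolding J_def by (intro integral_diff[symmetric] integrable_continuous_real cont)
    also have "norm \<dots> \<le> (K * dist \<phi> \<psi>) * (t - - T)"
    proof (rule integral_bound)
      show "continuous_on {-T..t} (\<lambda>s. G (apply_bcontfun \<phi> s) - G (apply_bcontfun \<psi> s))"
        by (intro continuous_on_diff cont)
      fix s
      have "norm (G (apply_bcontfun \<phi> s) - G (apply_bcontfun \<psi> s)) \<le> K * dist (apply_bcontfun \<phi> s) (apply_bcontfun \<psi> s)"
        using lip by (simp add: dist_norm)
      also have "\<dots> \<le> K * dist \<phi> \<psi>" using assms(1) by (intro mult_left_mono dist_bounded)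
      finally show "norm (G (apply_bcontfun \<phi> s) - G (apply_bcontfun \<psi> s)) \<le> K * dist \<phi> \<psi>" .
    qed (use t in auto)
    also have "\<dots> \<le> (K * dist \<phi> \<psi>) * (2 * T)" using t assms(1) by (intro mult_left_mono) auto
    finally show ?thesis by (simp add: mult_ac)
  qed
  have "\<exists>!\<phi>. Bcontfun (\<Phi> \<phi>) = \<phi>"
  proof (rule banach_fix_type)
    show "0 \<le> 4 * T * K" "4 * T * K < 1" using T assms(1) by auto
    show "\<forall>\<phi> \<psi>. dist (Bcontfun (\<Phi> \<phi>)) (Bcontfun (\<Phi> \<psi>)) \<le> 4 * T * K * dist \<phi> \<psi>"
    proof (intro allI dist_bound)
      fix \<phi> \<psi> t
      have "\<Phi> \<phi> t - \<Phi> \<psi> t = (J \<phi> (C t) - J \<psi> (C t)) - (J \<phi> 0 - J \<psi> 0)" by (simp add: \<Phi>_def)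
      also have "norm \<dots> \<le> norm (J \<phi> (C t) - J \<psi> (C t)) + norm (J \<phi> 0 - J \<psi> 0)" by (rule norm_triangle_ineq4)
      also have "\<dots> \<le> 4 * T * K * dist \<phi> \<psi>"
        using Jdist[OF C[of t], of \<phi> \<psi>] Jdist[of 0 \<phi> \<psi>] T(1) by simp
      finally show "dist (apply_bcontfun (Bcontfun (\<Phi> \<phi>)) t) (apply_bcontfun (Bcontfun (\<Phi> \<psi>)) t) \<le> 4 * T * K * dist \<phi> \<psi>"
        by (simp add: app dist_norm)
    qed
  qed
  then obtain \<phi> where "Bcontfun (\<Phi> \<phi>) = \<phi>" by blast
  then have fp: "apply_bcontfun \<phi> = \<Phi> \<phi>" using app by metis
  show thesis
  proof (rule that[OF T(1)])
    show "apply_bcontfun \<phi> 0 = x0" using T(1) by (simp add: fp \<Phi>_def C_def)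
    fix t assume t: "t \<in> {-T<..<T}"
    have "(J \<phi> has_vector_derivative G (apply_bcontfun \<phi> t)) (at t within {-T..T})"
      unfolding J_def using integral_has_vector_derivative[OF cont] t by auto
    then have "(J \<phi> has_vector_derivative G (apply_bcontfun \<phi> t)) (at t)"
      using t at_within_Icc_at[of "-T" t T] by auto
    then have "((\<lambda>t. x0 + J \<phi> t - J \<phi> 0) has_vector_derivative G (apply_bcontfun \<phi> t)) (at t)"
      by (auto intro!: derivative_eq_intros)
    then show "(apply_bcontfun \<phi> has_vector_derivative G (apply_bcontfun \<phi> t)) (at t)"
      by (rule has_vector_derivative_transform_within_open[where S = "{-T<..<T}"])
        (use t in \<open>auto simp: fp \<Phi>_def C_def min_def max_def\<close>)
  qed
qed

text \<open>Composing with the nearest-point projection to the ball, which does not increase distances,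
  extends the field to a globally Lipschitz one; by continuity its solution stays in the ball for a
  short time, where the two fields agree.\<close>

lemma picard_local:
  fixes F :: "'e::euclidean_space \<Rightarrow> 'e"
  assumes "r > 0" "K \<ge> 0"
    and lip: "\<And>x y. x \<in> cball x0 r \<Longrightarrow> y \<in> cball x0 r \<Longrightarrow> norm (F x - F y) \<le> K * norm (x - y)"
  obtains \<epsilon> x where "\<epsilon> > 0" "x 0 = x0"
    "\<And>t. t \<in> {-\<epsilon><..<\<epsilon>} \<Longrightarrow> x t \<in> cball x0 r"
    "\<And>t. t \<in> {-\<epsilon><..<\<epsilon>} \<Longrightarrow> (x has_vector_derivative F (x t)) (at t)"
proof -
  let ?p = "closest_point (cball x0 r)"
  have ne: "cball x0 r \<noteq> {}" using assms(1) by auto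
  have p: "?p x \<in> cball x0 r" for x by (rule closest_point_in_set) (use ne in auto)
  have "norm (F (?p x) - F (?p y)) \<le> K * norm (x - y)" for x y
  proof -
    have "norm (F (?p x) - F (?p y)) \<le> K * dist (?p x) (?p y)" using lip[OF p p] by (simp add: dist_norm)
    also have "\<dots> \<le> K * dist x y"
      using ne assms(2) by (intro mult_left_mono closest_point_lipschitz) auto
    finally show ?thesis by (simp add: dist_norm)
  qed
  with assms(2) obtain T x where T: "T > 0" "x 0 = x0"
    "\<And>t. t \<in> {-T<..<T} \<Longrightarrow> (x has_vector_derivative F (?p (x t))) (at t)"
    using picard_global_lipschitz[of K "\<lambda>x. F (?p x)" x0] by blast
  have "isCont x 0" by (rule has_vector_derivative_continuous[OF T(3)[of 0]]) (use T(1) in auto)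
  then obtain \<delta> where \<delta>: "\<delta> > 0" "\<And>t. dist t 0 < \<delta> \<Longrightarrow> dist (x t) (x 0) < r"
    unfolding continuous_at_eps_delta using assms(1) by (auto simp: dist_norm)
  show thesis
  proof (rule that[of "min T \<delta>" x])
    show "min T \<delta> > 0" "x 0 = x0" using T \<delta> by auto
    fix t assume t: "t \<in> {- min T \<delta><..<min T \<delta>}"
    have "dist (x t) x0 < r" using \<delta>(2)[of t] t T(2) by auto
    then show m: "x t \<in> cball x0 r" by (simp add: dist_commute less_imp_le)
    have "t \<in> {-T<..<T}" using t by auto
    from T(3)[OF this] show "(x has_vector_derivative F (x t)) (at t)"
      by (simp add: closest_point_self[OF m])
  qed
qed

text \<open>For a curve \<open>f \<circ> y\<close> in the image of an immersion, \<open>y\<close> being merely continuous. Let \<open>Q\<close> be the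
  projection along the range of \<open>A\<close> given by a left inverse of \<open>A\<close>. The increment of \<open>f\<close> is bounded
  below by a multiple of \<open>\<parallel>x - y 0\<parallel>\<close>, so that the error of the linear approximation, and with it the
  \<open>Q\<close>-component of the increment, is small compared to the increment itself. Along the curve
  the increment is of order \<open>t\<close>, hence \<open>Q w = 0\<close>.\<close>

lemma velocity_in_range_of_derivative:
  fixes f :: "'f::euclidean_space \<Rightarrow> 'e::euclidean_space" and y :: "real \<Rightarrow> 'f"
  assumes f: "(f has_derivative A) (at (y 0))" and "inj A" and "isCont y 0"
    and z: "(z has_vector_derivative w) (at 0)"
    and zy: "\<forall>\<^sub>F t in nhds 0. z t = f (y t)"
  shows "\<exists>u. A u = w"
proof -
  have linA: "linear A" using f by (rule has_derivative_linear)
  obtain \<beta> where \<beta>: "\<beta> > 0" "\<And>v. \<beta> * norm v \<le> norm (A v)"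
    using linear_inj_bounded_below_pos[OF linA assms(2)] by blast
  obtain g where g: "linear g" "g \<circ> A = id"
    using linear_injective_left_inverse[OF linA assms(2)] by blast
  define Q where "Q v = v - A (g v)" for v
  have gA: "g (A v) = v" for v using g(2) by (metis comp_apply id_apply)
  have linQ: "linear Q" unfolding Q_def
    by (intro linear_compose_sub[of "\<lambda>v. v", unfolded o_def] linear_ident linear_compose[OF g(1) linA, unfolded o_def])
  have QA: "Q (A v) = 0" for v by (simp add: Q_def gA)
  obtain q where q: "q > 0" "\<And>v. norm (Q v) \<le> norm v * q"
    using bounded_linear.pos_bounded linQ by (metis linear_conv_bounded_linear)
  have z0: "z 0 = f (y 0)" using eventually_nhds_x_imp_x[OF zy] .
  have est: "norm (Q w) \<le> \<epsilon> * (q + norm w + 1)" if e: "0 < \<epsilon>" "\<epsilon> \<le> 1" for \<epsilon>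
  proof -
    \<comment> \<open>The first bound makes the increment bounded below, the second makes the error small against it.\<close>
    define \<epsilon>' where "\<epsilon>' = min (\<beta> / 2) (\<epsilon> * \<beta> / (2 * q))"
    have e': "\<epsilon>' > 0" using \<beta> e q by (simp add: \<epsilon>'_def)
    have le: "\<epsilon>' \<le> \<beta> / 2" "\<epsilon>' \<le> \<epsilon> * \<beta> / (2 * q)" by (simp_all add: \<epsilon>'_def)
    obtain d where d: "d > 0" "\<And>x. norm (x - y 0) < d \<Longrightarrow> norm (f x - f (y 0) - A (x - y 0)) \<le> \<epsilon>' * norm (x - y 0)"
      using f e' unfolding has_derivative_at_alt by blast
    have bound: "norm (Q (f x - f (y 0))) \<le> \<epsilon> * norm (f x - f (y 0))" if x: "norm (x - y 0) < d" for x
    proof -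
      have "\<beta> * norm (x - y 0) \<le> norm (A (x - y 0))" by (rule \<beta>(2))
      also have "\<dots> \<le> norm (f x - f (y 0)) + norm (f x - f (y 0) - A (x - y 0))"
        by (metis norm_minus_commute norm_triangle_sub)
      also have "\<dots> \<le> norm (f x - f (y 0)) + \<beta> / 2 * norm (x - y 0)"
        by (rule add_left_mono[OF order_trans[OF d(2)[OF x] mult_right_mono[OF le(1) norm_ge_zero]]])
      finally have b: "norm (x - y 0) \<le> 2 / \<beta> * norm (f x - f (y 0))" using \<beta>(1) by (simp add: field_simps)
      have "Q (f x - f (y 0)) = Q (f x - f (y 0) - A (x - y 0))"
        by (simp add: linear_diff[OF linQ] QA)
      then have "norm (Q (f x - f (y 0))) \<le> norm (f x - f (y 0) - A (x - y 0)) * q" using q(2) by metis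
      also have "\<dots> \<le> (\<epsilon> * \<beta> / (2 * q) * norm (x - y 0)) * q"
        using order_trans[OF d(2)[OF x] mult_right_mono[OF le(2) norm_ge_zero]] q(1)
        by (intro mult_right_mono) auto
      also have "\<dots> = \<epsilon> * \<beta> / 2 * norm (x - y 0)" using q(1) by simp
      also have "\<dots> \<le> \<epsilon> * \<beta> / 2 * (2 / \<beta> * norm (f x - f (y 0)))" using b e(1) \<beta>(1) by (intro mult_left_mono) auto
      also have "\<dots> = \<epsilon> * norm (f x - f (y 0))" using \<beta>(1) by simp
      finally show ?thesis .
    qed
    have "\<forall>\<^sub>F t in at 0. dist (y t) (y 0) < d"
      using assms(3) d(1) by (auto simp: isCont_def intro: tendstoD)
    then have ev1: "\<forall>\<^sub>F t in at 0. norm (y t - y 0) < d" by (simp add: dist_norm)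
    obtain d' where d': "d' > 0" "\<And>t. norm (t - 0) < d' \<Longrightarrow> norm (z t - z 0 - (t - 0) *\<^sub>R w) \<le> \<epsilon> * norm (t - 0)"
      using z e(1) unfolding has_vector_derivative_def has_derivative_at_alt by blast
    have ev2: "\<forall>\<^sub>F t in at 0. norm (z t - z 0 - t *\<^sub>R w) \<le> \<epsilon> * \<bar>t\<bar>"
      unfolding eventually_at using d' by auto
    have ev3: "\<forall>\<^sub>F t in at 0. z t = f (y t)" using zy by (rule eventually_nhds_conv_at[THEN iffD1, THEN conjunct1])
    have ev4: "\<forall>\<^sub>F t in at (0::real). t \<noteq> 0" by (simp add: eventually_at_filter)
    have "\<forall>\<^sub>F t in at 0. norm (y t - y 0) < d \<and> norm (z t - z 0 - t *\<^sub>R w) \<le> \<epsilon> * \<bar>t\<bar> \<and> z t = f (y t) \<and> t \<noteq> 0"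
      using ev1 ev2 ev3 ev4 by eventually_elim auto
    then obtain t where t: "norm (y t - y 0) < d" "norm (z t - z 0 - t *\<^sub>R w) \<le> \<epsilon> * \<bar>t\<bar>" "z t = f (y t)" "t \<noteq> 0"
      using eventually_happens'[OF at_neq_bot] by blast
    have Q1: "norm (Q (z t - z 0)) \<le> \<epsilon> * norm (z t - z 0)" using bound[OF t(1)] t(3) z0 by simp
    have n1: "norm (z t - z 0) \<le> \<bar>t\<bar> * norm w + \<epsilon> * \<bar>t\<bar>"
      using norm_triangle_ineq2[of "z t - z 0" "t *\<^sub>R w"] t(2) by simp
    have "\<bar>t\<bar> * norm (Q w) = norm (Q (t *\<^sub>R w))" by (simp add: linear_scale[OF linQ])
    also have "Q (t *\<^sub>R w) = Q (z t - z 0) - Q (z t - z 0 - t *\<^sub>R w)" by (simp add: linear_diff[OF linQ])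
    also have "norm \<dots> \<le> norm (Q (z t - z 0)) + norm (Q (z t - z 0 - t *\<^sub>R w))" by (rule norm_triangle_ineq4)
    also have "\<dots> \<le> \<epsilon> * (\<bar>t\<bar> * norm w + \<epsilon> * \<bar>t\<bar>) + (\<epsilon> * \<bar>t\<bar>) * q"
      using order_trans[OF Q1 mult_left_mono[OF n1, of \<epsilon>]] e(1) order_trans[OF q(2) mult_right_mono[OF t(2), of q]] q(1)
      by (intro add_mono) auto
    also have "\<dots> \<le> \<bar>t\<bar> * (\<epsilon> * (q + norm w + 1))"
      using e mult_mono[of \<epsilon> 1 "\<epsilon> * \<bar>t\<bar>" "\<epsilon> * \<bar>t\<bar>"] by (simp add: algebra_simps)
    finally show ?thesis using t(4) by simp
  qed
  have "norm (Q w) \<le> 0"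
  proof (rule field_le_epsilon)
    fix e :: real assume e: "e > 0"
    let ?c = "q + norm w + 1"
    have c: "?c > 0" using q(1) norm_ge_zero[of w] by linarith
    have "norm (Q w) \<le> min 1 (e / ?c) * ?c" by (rule est) (use e c in auto)
    also have "\<dots> \<le> e / ?c * ?c" using c by (intro mult_right_mono) auto
    finally show "norm (Q w) \<le> 0 + e" using c by simp
  qed
  then have "A (g w) = w" by (simp add: Q_def)
  then show ?thesis by blast
qed

text \<open>On a ball of radius \<open>r\<close> with \<open>\<bar>K\<bar> * r < 1\<close>, let \<open>m\<close> be the maximum of \<open>\<bar>g\<bar>\<close>. The derivative is bounded
  by \<open>\<bar>K\<bar> * m\<close>, so the mean value inequality gives \<open>m \<le> \<bar>K\<bar> * m * r\<close> and hence \<open>m = 0\<close>.\<close>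

lemma zero_near_zero_if_derivative_bounded:
  fixes g :: "'f::euclidean_space \<Rightarrow> real"
  assumes "open U" "x0 \<in> U" "g x0 = 0"
    and g: "\<And>x. x \<in> U \<Longrightarrow> (g has_derivative g' x) (at x)"
    and bound: "\<And>x u. x \<in> U \<Longrightarrow> \<bar>g' x u\<bar> \<le> K * \<bar>g x\<bar> * norm u"
  shows "\<exists>V. open V \<and> x0 \<in> V \<and> (\<forall>x\<in>V. g x = 0)"
proof -
  obtain s where s: "s > 0" "cball x0 s \<subseteq> U" using assms(1,2) open_contains_cball by blast
  define r where "r = min s (1 / (2 * (\<bar>K\<bar> + 1)))"
  have r: "r > 0" "\<bar>K\<bar> * r < 1"
  proof -
    show "r > 0" using s by (auto simp: r_def)
    have "\<bar>K\<bar> * r \<le> \<bar>K\<bar> * (1 / (2 * (\<bar>K\<bar> + 1)))" by (intro mult_left_mono) (auto simp: r_def)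
    also have "\<dots> < 1" by (simp add: field_simps)
    finally show "\<bar>K\<bar> * r < 1" .
  qed
  have sub: "cball x0 r \<subseteq> U" using s(2) by (auto simp: r_def)
  have "continuous_on (cball x0 r) (\<lambda>x. \<bar>g x\<bar>)"
    using has_derivative_continuous[OF g] sub
    by (intro continuous_intros continuous_at_imp_continuous_on) auto
  then obtain \<xi> where \<xi>: "\<xi> \<in> cball x0 r" "\<And>x. x \<in> cball x0 r \<Longrightarrow> \<bar>g x\<bar> \<le> \<bar>g \<xi>\<bar>"
    using continuous_attains_sup[of "cball x0 r" "\<lambda>x. \<bar>g x\<bar>"] r(1) by auto
  have "norm (g \<xi> - g x0) \<le> (\<bar>K\<bar> * \<bar>g \<xi>\<bar>) * norm (\<xi> - x0)"
  proof (rule differentiable_bound[OF convex_cball])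
    show "(g has_derivative g' x) (at x within cball x0 r)" if "x \<in> cball x0 r" for x
      by (rule has_derivative_at_withinI[OF g[OF subsetD[OF sub that]]])
    show "onorm (g' x) \<le> \<bar>K\<bar> * \<bar>g \<xi>\<bar>" if x: "x \<in> cball x0 r" for x
    proof (rule onorm_le)
      fix u
      have "norm (g' x u) \<le> K * \<bar>g x\<bar> * norm u" using bound[OF subsetD[OF sub x], of u] by simp
      also have "\<dots> \<le> \<bar>K\<bar> * \<bar>g \<xi>\<bar> * norm u"
        using \<xi>(2)[OF x] by (intro mult_right_mono mult_mono) auto
      finally show "norm (g' x u) \<le> \<bar>K\<bar> * \<bar>g \<xi>\<bar> * norm u" .
    qed
  qed (use \<xi>(1) r(1) in auto)
  also have "\<dots> \<le> (\<bar>K\<bar> * \<bar>g \<xi>\<bar>) * r"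
    using \<xi>(1) by (intro mult_left_mono) (auto simp: dist_norm norm_minus_commute)
  finally have "\<bar>g \<xi>\<bar> * (1 - \<bar>K\<bar> * r) \<le> 0" using assms(3) by (simp add: algebra_simps)
  then have "g \<xi> = 0" using r(2) by (simp add: mult_le_0_iff)
  then show ?thesis
    using \<xi>(2) r(1) by (intro exI[of _ "ball x0 r"]) force
qed

section \<open>Integral curves of the field dual to a one-form\<close>

lemma coord1_smooth: "is_form1 M \<alpha> \<Longrightarrow> c \<in> atlas M \<Longrightarrow> Ck_on k (chart_img c) (\<lambda>x. coord1 M c \<alpha> x u)"
  by (simp add: is_form1_def smooth_on_def)

lemma coord2_smooth: "is_form2 M \<beta> \<Longrightarrow> c \<in> atlas M \<Longrightarrow> Ck_on k (chart_img c) (\<lambda>x. coord2 M c \<beta> x u v)"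
  by (simp add: is_form2_def smooth_on_def)

lemma
  assumes "smooth_manifold M" "c \<in> atlas M" "x \<in> chart_img c"
  shows charts_at_chart_inv: "c \<in> charts_at M (chart_inv c x)"
    and chart_inv_in_points: "chart_inv c x \<in> points M"
proof -
  have c: "is_chart (mtop M) c" using assms(1,2) by (simp add: smooth_manifold_def)
  show "c \<in> charts_at M (chart_inv c x)" "chart_inv c x \<in> points M"
    using assms(2) chart_inv_dom[OF c assms(3)] chart_dom_points[OF c] by (auto simp: charts_at_def)
qed

lemma linear_form1:
  assumes "smooth_manifold M" "is_form1 M \<alpha>" "c \<in> charts_at M p" "p \<in> points M"
  shows "linear (\<lambda>u. \<alpha> p (coord_vector M c p u))"
  using assms by (intro linear_on_tangent_coord) (auto simp: is_form1_def)

lemma linear_form2_left: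
  assumes "smooth_manifold M" "is_form2 M \<beta>" "c \<in> charts_at M p" "p \<in> points M"
    "w \<in> tangent_space M p"
  shows "linear (\<lambda>u. \<beta> p (coord_vector M c p u) w)"
  using assms by (intro linear_on_tangent_coord[where l = "\<lambda>u. \<beta> p u w"]) (auto simp: is_form2_def)

lemma is_form2_antisym:
  assumes "is_form2 M \<beta>" "p \<in> points M" "u \<in> tangent_space M p" "v \<in> tangent_space M p"
  shows "\<beta> p u v = - \<beta> p v u"
  using assms unfolding is_form2_def by blast

lemma linear_form2_right:
  assumes "smooth_manifold M" "is_form2 M \<beta>" "c \<in> charts_at M p" "p \<in> points M"
    "v \<in> tangent_space M p"
  shows "linear (\<lambda>u. \<beta> p v (coord_vector M c p u))"
proof -
  have "(\<lambda>u. \<beta> p v (coord_vector M c p u)) = (\<lambda>u. - \<beta> p (coord_vector M c p u) v)"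
    using is_form2_antisym[OF assms(2,4,5) coord_vector_in_tangent_space[OF assms(1,3)]] by (rule ext)
  then show ?thesis
    using linear_compose_neg[OF linear_form2_left[OF assms]] by simp
qed

text \<open>In a chart, the field solves the linear system whose matrix is that of \<open>\<omega>\<close> and whose right-hand
  side is \<open>\<alpha>\<close>. Non-degeneracy makes it locally Lipschitz, so Picard's theorem gives a solution in
  the chart; by the change of charts for tangent vectors it is an integral curve in all charts.\<close>

lemma integral_curve_of_dual_field_exists:
  fixes M :: "('a, 'e::euclidean_space) manifold"
  assumes M: "smooth_manifold M" and \<omega>: "is_form2 M \<omega>" "nondegenerate M \<omega>" and \<alpha>: "is_form1 M \<alpha>"
    and X: "\<And>p. p \<in> points M \<Longrightarrow> X p \<in> tangent_space M p"
    and dual: "\<And>p v. p \<in> points M \<Longrightarrow> v \<in> tangent_space M p \<Longrightarrow> \<omega> p (X p) v = \<alpha> p v"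
    and p: "p \<in> points M"
  obtains I \<gamma> where "integral_curve M X I \<gamma>" "0 \<in> I" "\<gamma> 0 = p"
proof -
  define c where "c = some_chart M p"
  have cp: "c \<in> charts_at M p" using some_chart_in[OF M p] by (simp add: c_def)
  note c = charts_atD[OF M cp]
  let ?U = "chart_img c" and ?q = "chart_inv c"
  have oU: "open ?U" by (rule chart_img_open[OF c(1)])
  have x0: "chart_fun c p \<in> ?U" by (rule chart_fun_in_img[OF c(3)])
  have q0: "?q (chart_fun c p) = p" by (rule chart_inv_fun[OF c(1,3)])
  have cq: "c \<in> charts_at M (?q x)" and qM: "?q x \<in> points M" if "x \<in> ?U" for x
    using charts_at_chart_inv[OF M c(2) that] chart_inv_in_points[OF M c(2) that] .
  note cv = coord_vector_in_tangent_space[OF M]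
  define B where "B x v = (\<Sum>j\<in>Basis. coord2 M c \<omega> x v j *\<^sub>R j)" for x v
  define b where "b x = (\<Sum>j\<in>Basis. coord1 M c \<alpha> x j *\<^sub>R (j :: 'e))" for x
  define Y where "Y x = X (?q x) c" for x
  have lin: "linear (B x)" if x: "x \<in> ?U" for x
    unfolding B_def coord2_def Let_def
    by (intro linear_compose_sum ballI linear_compose[OF linear_form2_left[OF M \<omega>(1) cq[OF x] qM[OF x] cv[OF cq[OF x]]]
            bounded_linear.linear[OF bounded_linear_scaleR_left], unfolded o_def])
  have B1: "Ck_on 1 ?U (\<lambda>x. B x v)" for v
    unfolding B_def by (intro Ck_on_sum Ck_on_scaleR Ck_on_const oU coord2_smooth[OF \<omega>(1) c(2)])
  have b1: "Ck_on 1 ?U b"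
    unfolding b_def by (intro Ck_on_sum Ck_on_scaleR Ck_on_const oU coord1_smooth[OF \<alpha> c(2)])
  have eq: "B x (Y x) = b x" if x: "x \<in> ?U" for x
  proof -
    have "coord_vector M c (?q x) (Y x) = X (?q x)"
      unfolding Y_def by (rule tangent_vector_eq_coord_vector[OF X[OF qM[OF x]] cq[OF x], symmetric])
    then show ?thesis
      using dual[OF qM[OF x] cv[OF cq[OF x]]] by (simp add: B_def b_def coord2_def coord1_def Let_def)
  qed
  have inj: "inj (B (chart_fun c p))"
  proof (rule linear_injective_0[OF lin[OF x0], THEN iffD2], intro allI impI)
    fix v assume "B (chart_fun c p) v = 0"
    then have *: "B (chart_fun c p) v \<bullet> j = 0" for j by simp
    have z: "\<omega> p (coord_vector M c p v) (coord_vector M c p j) = 0" if "j \<in> Basis" for j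
      using *[unfolded B_def, of j] unfolding inner_sum_left_Basis[OF that] by (simp add: coord2_def q0)
    have "\<omega> p (coord_vector M c p v) w = 0" if w: "w \<in> tangent_space M p" for w
    proof -
      have "\<omega> p (coord_vector M c p v) (coord_vector M c p (w c)) = 0"
        by (subst linear_eq_sum_Basis[OF linear_form2_right[OF M \<omega>(1) cp p cv[OF cp]]]) (simp add: z)
      then show ?thesis using tangent_vector_eq_coord_vector[OF w cp] by simp
    qed
    then have "coord_vector M c p v c = 0"
      using \<omega>(2) p cv[OF cp] unfolding nondegenerate_def by blast
    then show "v = 0" by (simp add: coord_vector_apply[OF M cp])
  qed
  obtain r K where r: "r > 0" "cball (chart_fun c p) r \<subseteq> ?U" "K \<ge> 0"
    "\<And>x y. x \<in> cball (chart_fun c p) r \<Longrightarrow> y \<in> cball (chart_fun c p) r \<Longrightarrow> norm (Y x - Y y) \<le> K * norm (x - y)"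
    using solution_of_linear_system_lipschitz[OF oU x0 lin B1 b1 eq inj] by blast
  obtain \<epsilon> x where x: "\<epsilon> > 0" "x 0 = chart_fun c p"
    "\<And>t. t \<in> {-\<epsilon><..<\<epsilon>} \<Longrightarrow> x t \<in> cball (chart_fun c p) r"
    "\<And>t. t \<in> {-\<epsilon><..<\<epsilon>} \<Longrightarrow> (x has_vector_derivative Y (x t)) (at t)"
    using picard_local[OF r(1,3,4)] by blast
  define I where "I = {-\<epsilon><..<\<epsilon>}"
  have xU: "x t \<in> ?U" if "t \<in> I" for t using x(3) r(2) that by (auto simp: I_def)
  have "integral_curve M X I (?q \<circ> x)"
    unfolding integral_curve_def
  proof (intro conjI ballI)
    show "open I" by (simp add: I_def)
    show "is_interval I" by (auto simp: I_def is_interval_1)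
    have "continuous_on I x"
      using x(4) by (intro continuous_at_imp_continuous_on ballI has_vector_derivative_continuous) (auto simp: I_def)
    then have "continuous_map (top_of_set I) (top_of_set ?U) x"
      using xU by (auto simp: continuous_map_in_subtopology)
    then show "continuous_map (top_of_set I) (mtop M) (?q \<circ> x)"
      by (rule continuous_map_compose[OF _ chart_inv_continuous[OF c(1)]])
    fix t d assume t: "t \<in> I" and d: "d \<in> charts_at M ((?q \<circ> x) t)"
    let ?p = "?q (x t)"
    have cp': "c \<in> charts_at M ?p" using cq[OF xU[OF t]] .
    have d': "d \<in> charts_at M ?p" using d by simp
    have xt: "x t = chart_fun c ?p" by (simp add: chart_fun_inv[OF c(1) xU[OF t]])
    have T: "(chart_fun d \<circ> ?q has_derivative transition_deriv c d ?p) (at (x t))"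
      using transition_has_derivative[OF smooth_map_id, OF M M M cp' d'] by (subst xt)
    have "(x has_derivative (\<lambda>h. h *\<^sub>R Y (x t))) (at t)"
      using x(4)[of t] t by (simp add: has_vector_derivative_def I_def)
    from diff_chain_at[OF this T]
    have "((chart_fun d \<circ> ?q) \<circ> x has_derivative (\<lambda>h. h *\<^sub>R transition_deriv c d ?p (Y (x t)))) (at t)"
      by (simp add: o_def linear_scale[OF linear_transition_deriv[OF M cp' d'], unfolded o_def])
    moreover have "transition_deriv c d ?p (Y (x t)) = X ?p d"
      unfolding Y_def by (rule tangent_vector_change_chart[OF X[OF qM[OF xU[OF t]]] cp' d', symmetric])
    ultimately show "((\<lambda>s. chart_fun d ((?q \<circ> x) s)) has_vector_derivative X ((?q \<circ> x) t) d) (at t)"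
      by (simp add: has_vector_derivative_def o_def)
  qed
  then show thesis using x(1,2) q0 by (intro that[of I "?q \<circ> x"]) (auto simp: I_def)
qed

section \<open>Vector fields preserving a submanifold\<close>

lemma submanifoldD:
  assumes "submanifold L M"
  shows "smooth_manifold L" "points L \<subseteq> points M" "smooth_map L M id"
    "mtop L = subtopology (mtop M) (points L)"
    "p \<in> points L \<Longrightarrow> inj_on (tangent_map L M id p) (tangent_space L p)"
  using assms by (simp_all add: submanifold_def)

lemma tangent_map_in_tangent_space:
  assumes "smooth_map L M id" "smooth_manifold L" "smooth_manifold M" "p \<in> points L" "p \<in> points M"
    "v \<in> tangent_space L p"
  shows "tangent_map L M id p v \<in> tangent_space M p"
  using tangent_map_in_charts[OF assms(1-4) some_chart_in[OF assms(2,4)] some_chart_in[OF assms(3,5)] assms(6)]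
    coord_vector_in_tangent_space[OF assms(3) some_chart_in[OF assms(3,5)]] by simp

text \<open>The topology of \<open>L\<close> is that of a subspace, so the curve is continuous in \<open>L\<close> and, near time 0, the image of a
  continuous curve in a chart of \<open>L\<close>; then its velocity lies in the range of the derivative of the
  inclusion.\<close>

lemma integral_curve_in_submanifold_tangent:
  assumes M: "smooth_manifold M" and L: "submanifold L M"
    and X: "X (\<gamma> 0) \<in> tangent_space M (\<gamma> 0)"
    and \<gamma>: "integral_curve M X I \<gamma>" "0 \<in> I" "\<And>t. t \<in> I \<Longrightarrow> \<gamma> t \<in> points L"
  obtains u where "u \<in> tangent_space L (\<gamma> 0)" "tangent_map L M id (\<gamma> 0) u = X (\<gamma> 0)"
proof -
  let ?p = "\<gamma> 0"
  note Ls = submanifoldD[OF L]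
  have pL: "?p \<in> points L" using \<gamma> by blast
  then have pM: "?p \<in> points M" using Ls(2) by blast
  define c where "c = some_chart L ?p"
  define d where "d = some_chart M ?p"
  have cp: "c \<in> charts_at L ?p" and dp: "d \<in> charts_at M ?p"
    unfolding c_def d_def by (rule some_chart_in[OF Ls(1) pL], rule some_chart_in[OF M pM])
  note c = charts_atD[OF Ls(1) cp]
  note tm = tangent_map_in_charts[OF Ls(3,1) M pL cp dp]
  note cv = coord_vector_in_tangent_space[OF Ls(1) cp] and cva = coord_vector_apply[OF Ls(1) cp]
  have "inj (transition_deriv c d ?p)"
  proof (rule injI)
    fix u w assume "transition_deriv c d ?p u = transition_deriv c d ?p w"
    then have "tangent_map L M id ?p (coord_vector L c ?p u) = tangent_map L M id ?p (coord_vector L c ?p w)"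
      by (simp only: tm[OF cv] cva)
    then have "coord_vector L c ?p u = coord_vector L c ?p w"
      using inj_onD[OF Ls(5)[OF pL]] cv by blast
    then show "u = w" using cva by metis
  qed
  have oI: "open I" using \<gamma>(1) by (simp add: integral_curve_def)
  have cont: "continuous_map (top_of_set I) (mtop L) \<gamma>"
  proof -
    have "continuous_map (top_of_set I) (subtopology (mtop M) (points L)) \<gamma>"
      using \<gamma>(1,3) by (auto simp: integral_curve_def continuous_map_in_subtopology)
    then show ?thesis using Ls(4) by metis
  qed
  define W where "W = {t \<in> I. \<gamma> t \<in> chart_dom c}"
  have "openin (top_of_set I) W"
    using openin_continuous_map_preimage[OF cont chart_dom_open[OF c(1)]] by (simp add: W_def)
  then have oW: "open W" using oI openin_open_eq by blast
  have W0: "0 \<in> W" using \<gamma>(2) c(3) by (simp add: W_def)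
  have "continuous_map (top_of_set W) (subtopology (mtop L) (chart_dom c)) \<gamma>"
    using continuous_map_from_subtopology_mono[OF cont, of W]
    by (auto simp: continuous_map_in_subtopology W_def)
  then have "continuous_map (top_of_set W) euclidean (chart_fun c \<circ> \<gamma>)"
    by (rule continuous_map_compose[OF _ chart_continuous[OF c(1)]])
  then have cy: "isCont (\<lambda>t. chart_fun c (\<gamma> t)) 0"
    using continuous_on_eq_continuous_at[OF oW, THEN iffD1, rule_format, OF _ W0] by (simp add: o_def)
  have "\<exists>u. transition_deriv c d ?p u = X ?p d"
  proof (rule velocity_in_range_of_derivative[where f = "chart_fun d \<circ> chart_inv c"
        and y = "\<lambda>t. chart_fun c (\<gamma> t)" and z = "\<lambda>t. chart_fun d (\<gamma> t)"])
    show "(chart_fun d \<circ> chart_inv c has_derivative transition_deriv c d ?p) (at (chart_fun c (\<gamma> 0)))"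
      by (rule transition_has_derivative[OF Ls(3,1) M cp dp])
    show "((\<lambda>t. chart_fun d (\<gamma> t)) has_vector_derivative X (\<gamma> 0) d) (at 0)"
      using \<gamma>(1,2) dp by (simp add: integral_curve_def)
    show "\<forall>\<^sub>F t in nhds 0. chart_fun d (\<gamma> t) = (chart_fun d \<circ> chart_inv c) (chart_fun c (\<gamma> t))"
      unfolding eventually_nhds
      by (rule exI[of _ W]) (use oW W0 in \<open>auto simp: W_def chart_inv_fun[OF c(1)]\<close>)
  qed fact+
  then obtain u where u: "transition_deriv c d ?p u = X ?p d" by blast
  have "tangent_map L M id ?p (coord_vector L c ?p u) = coord_vector M d ?p (X ?p d)"
    by (simp only: tm[OF cv] cva u)
  also have "\<dots> = X ?p" by (rule tangent_vector_eq_coord_vector[OF X dp, symmetric])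
  finally show thesis using cv that by blast
qed

section \<open>Restriction of functions and forms\<close>

lemma differential_tangent_map:
  assumes "smooth_map L M id" "smooth_manifold L" "smooth_manifold M" "p \<in> points L" "p \<in> points M"
    "smooth_fun M H" "v \<in> tangent_space L p"
  shows "differential M H p (tangent_map L M id p v) = differential L H p v"
proof -
  define c where "c = some_chart L p"
  define d where "d = some_chart M p"
  have c: "c \<in> charts_at L p" and d: "d \<in> charts_at M p"
    unfolding c_def d_def by (rule some_chart_in[OF assms(2,4)], rule some_chart_in[OF assms(3,5)])
  let ?DH = "frechet_derivative (H \<circ> chart_inv d) (at (chart_fun d p))"
  have "tangent_map L M id p v d = transition_deriv c d p (v c)"
    by (simp only: tangent_map_in_charts[OF assms(1-4) c d assms(7)] coord_vector_apply[OF assms(3) d])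
  then have "differential M H p (tangent_map L M id p v) = ?DH (transition_deriv c d p (v c))"
    by (simp only: differential_in_chart[OF assms(3,6,5) d tangent_map_in_tangent_space[OF assms(1-5,7)]])
  also have "\<dots> = differential L H p v"
    by (simp only: differential_in_chart[OF assms(2) smooth_fun_restrict[OF assms(1-3,6)] assms(4) c assms(7)]
        frechet_eqI[OF chart_change_has_derivative[OF assms(1-3) c d smooth_fun_has_derivative[OF assms(6) d]]] o_apply)
  finally show ?thesis .
qed

text \<open>The Hamiltonian field is dual to this form, which has to be smooth for integral curves to exist.\<close>

lemma is_form1_lee_deriv0:
  assumes M: "smooth_manifold M" and \<eta>: "is_form1 M \<eta>" and H: "smooth_fun M H"
  shows "is_form1 M (lee_deriv0 M \<eta> H)"
proof -
  have "linear_on_tangent M p (lee_deriv0 M \<eta> H p)" if p: "p \<in> points M" for p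
  proof -
    let ?c = "some_chart M p"
    have lin: "linear (frechet_derivative (H \<circ> chart_inv ?c) (at (chart_fun ?c p)))"
      using smooth_fun_has_derivative[OF H some_chart_in[OF M p]] by (rule has_derivative_linear)
    have "linear_on_tangent M p (\<eta> p)" using \<eta> p by (simp add: is_form1_def)
    then show ?thesis
      by (simp add: linear_on_tangent_def lee_deriv0_def differential_def Let_def
          linear_add[OF lin] linear_scale[OF lin] algebra_simps)
  qed
  moreover have "Ck_on k (chart_img c) (\<lambda>x. coord1 M c (lee_deriv0 M \<eta> H) x u)" if c: "c \<in> atlas M" for c u k
  proof -
    have ch: "is_chart (mtop M) c" using M c by (simp add: smooth_manifold_def)
    have oU: "open (chart_img c)" by (rule chart_img_open[OF ch])
    have Hk: "Ck_on m (chart_img c) (H \<circ> chart_inv c)" for m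
      using H c by (simp add: smooth_fun_def smooth_on_def)
    have "Ck_on k (chart_img c) (\<lambda>x. frechet_derivative (H \<circ> chart_inv c) (at x) u
        + (H \<circ> chart_inv c) x *\<^sub>R ((-1) *\<^sub>R coord1 M c \<eta> x u))"
      using Hk[of "Suc k"] by (intro Ck_on_add Ck_on_scaleR Ck_on_const coord1_smooth[OF \<eta> c] Hk oU) simp
    then show ?thesis
    proof (rule Ck_on_cong[OF oU, rotated])
      fix x assume x: "x \<in> chart_img c"
      note ca = charts_at_chart_inv[OF M c x]
      show "frechet_derivative (H \<circ> chart_inv c) (at x) u + (H \<circ> chart_inv c) x *\<^sub>R ((-1) *\<^sub>R coord1 M c \<eta> x u)
          = coord1 M c (lee_deriv0 M \<eta> H) x u"
        by (simp add: coord1_def Let_def lee_deriv0_def coord_vector_apply[OF M ca] chart_fun_inv[OF ch x]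
          differential_in_chart[OF M H chart_inv_in_points[OF M c x] ca coord_vector_in_tangent_space[OF M ca]])
    qed
  qed
  ultimately show ?thesis by (simp add: is_form1_def smooth_on_def)
qed

lemma tangent_space_lincomb:
  assumes "smooth_manifold M" "c \<in> charts_at M p" "v \<in> tangent_space M p" "w \<in> tangent_space M p"
  shows "(\<lambda>d. a *\<^sub>R v d + b *\<^sub>R w d) = coord_vector M c p (a *\<^sub>R v c + b *\<^sub>R w c)"
  unfolding coord_vector_linear[OF assms(1,2)]
  using tangent_vector_eq_coord_vector[OF assms(3,2)] tangent_vector_eq_coord_vector[OF assms(4,2)] by simp

text \<open>Near each point the coefficients of the pull-back are sums of coefficients of \<open>\<alpha>\<close> in an ambient
  chart, composed with the inclusion, multiplied by entries of the derivative of the inclusion.\<close>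

lemma is_form1_pullback1:
  assumes "smooth_map L M id" "smooth_manifold L" "smooth_manifold M" "is_form1 M \<alpha>"
  shows "is_form1 L (pullback1 L M id \<alpha>)"
proof -
  have pM: "p \<in> points M" if "p \<in> points L" for p
    using assms(1) that by (auto simp: smooth_map_def continuous_map_def)
  have pb: "pullback1 L M id \<alpha> p (coord_vector L c p u) = \<alpha> p (coord_vector M d p (transition_deriv c d p u))"
    if "p \<in> points L" "c \<in> charts_at L p" "d \<in> charts_at M p" for p c d u
    by (simp only: pullback1_def id_apply coord_vector_apply[OF assms(2) that(2)]
        tangent_map_in_charts[OF assms(1-3) that coord_vector_in_tangent_space[OF assms(2) that(2)]])
  have lin: "linear (\<lambda>u. \<alpha> p (coord_vector M d p (transition_deriv c d p u)))"
    if "p \<in> points L" "c \<in> charts_at L p" "d \<in> charts_at M p" for p c d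
    using linear_compose[OF has_derivative_linear[OF transition_has_derivative[OF assms(1-3) that(2,3)]]
      linear_form1[OF assms(3,4) that(3) pM[OF that(1)]]] by (simp add: o_def)
  have "linear_on_tangent L p (pullback1 L M id \<alpha> p)" if p: "p \<in> points L" for p
    unfolding linear_on_tangent_def
  proof (intro ballI allI)
    fix v w a b assume vw: "v \<in> tangent_space L p" "w \<in> tangent_space L p"
    define c where "c = some_chart L p"
    define d where "d = some_chart M p"
    have c: "c \<in> charts_at L p" and d: "d \<in> charts_at M p"
      unfolding c_def d_def by (rule some_chart_in[OF assms(2) p], rule some_chart_in[OF assms(3) pM[OF p]])
    have v: "pullback1 L M id \<alpha> p v = \<alpha> p (coord_vector M d p (transition_deriv c d p (v c)))"
      if "v \<in> tangent_space L p" for v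
      using pb[OF p c d, of "v c"] tangent_vector_eq_coord_vector[OF that c] by simp
    show "pullback1 L M id \<alpha> p (\<lambda>c. a *\<^sub>R v c + b *\<^sub>R w c) =
        a * pullback1 L M id \<alpha> p v + b * pullback1 L M id \<alpha> p w"
      unfolding tangent_space_lincomb[OF assms(2) c vw] pb[OF p c d] v[OF vw(1)] v[OF vw(2)]
      using linear_add[OF lin[OF p c d]] linear_scale[OF lin[OF p c d]] by simp
  qed
  moreover have "Ck_on k (chart_img c) (\<lambda>x. coord1 L c (pullback1 L M id \<alpha>) x u)" if cL: "c \<in> atlas L" for c u k
  proof (rule Ck_on_local)
    have c: "is_chart (mtop L) c" using assms(2) cL by (simp add: smooth_manifold_def)
    fix x assume x: "x \<in> chart_img c"
    have qM: "chart_inv c x \<in> points M" by (rule pM[OF chart_inv_in_points[OF assms(2) cL x]])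
    define d where "d = some_chart M (chart_inv c x)"
    note d = charts_atD[OF assms(3) some_chart_in[OF assms(3) qM, folded d_def]]
    let ?S = "chart_fun c ` (chart_dom c \<inter> chart_dom d)" and ?f = "chart_fun d \<circ> chart_inv c"
    have oS: "open ?S" by (rule overlap_open[OF assms(1-3) cL d(2)])
    have fk: "Ck_on m ?S ?f" for m by (rule overlap_smooth[OF assms(1) cL d(2)])
    have "Ck_on k ?S ((\<lambda>y. coord1 M d \<alpha> y j) \<circ> ?f)" for j
      by (rule Ck_on_compose[OF oS _ fk coord1_smooth[OF assms(4) d(2)]])
        (auto simp: chart_inv_fun[OF c] chart_fun_in_img)
    moreover have "Ck_on k ?S (\<lambda>y. frechet_derivative ?f (at y) u \<bullet> j)" for j
      using fk[of "Suc k"] by (intro Ck_on_bounded_linear[OF oS bounded_linear_inner_left]) simp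
    ultimately have "Ck_on k ?S (\<lambda>y. \<Sum>j\<in>Basis. (frechet_derivative ?f (at y) u \<bullet> j) *\<^sub>R ((\<lambda>y. coord1 M d \<alpha> y j) \<circ> ?f) y)"
      by (intro Ck_on_sum[OF oS] Ck_on_scaleR[OF oS])
    then have "Ck_on k ?S (\<lambda>x. coord1 L c (pullback1 L M id \<alpha>) x u)"
    proof (rule Ck_on_cong[OF oS, rotated])
      fix y assume "y \<in> ?S"
      then obtain q where q: "q \<in> chart_dom c" "q \<in> chart_dom d" "y = chart_fun c q" by auto
      have qc: "chart_inv c y = q" and qd: "chart_inv d (chart_fun d q) = q"
        using q chart_inv_fun[OF c q(1)] chart_inv_fun[OF d(1) q(2)] by auto
      have cq: "c \<in> charts_at L q" and dq: "d \<in> charts_at M q" using q cL d(2) by (auto simp: charts_at_def)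
      have qL: "q \<in> points L" using q(1) chart_dom_points[OF c] by auto
      have "coord1 L c (pullback1 L M id \<alpha>) y u = \<alpha> q (coord_vector M d q (transition_deriv c d q u))"
        by (simp only: coord1_def Let_def qc pb[OF qL cq dq])
      also have "\<dots> = (\<Sum>j\<in>Basis. (transition_deriv c d q u \<bullet> j) *\<^sub>R \<alpha> q (coord_vector M d q j))"
        by (rule linear_eq_sum_Basis[OF linear_form1[OF assms(3,4) dq pM[OF qL]]])
      also have "\<dots> = (\<Sum>j\<in>Basis. (frechet_derivative ?f (at y) u \<bullet> j) *\<^sub>R ((\<lambda>y. coord1 M d \<alpha> y j) \<circ> ?f) y)"
        by (simp only: o_apply coord1_def Let_def qc qd q(3)[symmetric])
      finally show "(\<Sum>j\<in>Basis. (frechet_derivative ?f (at y) u \<bullet> j) *\<^sub>R ((\<lambda>y. coord1 M d \<alpha> y j) \<circ> ?f) y) =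
          coord1 L c (pullback1 L M id \<alpha>) y u" by (rule sym)
    qed
    moreover have "x \<in> ?S"
      using d(3) x chart_inv_dom[OF c x] chart_fun_inv[OF c x] by (metis IntI imageI)
    ultimately show "\<exists>T. open T \<and> x \<in> T \<and> Ck_on k T (\<lambda>x. coord1 L c (pullback1 L M id \<alpha>) x u)"
      using oS by blast
  qed
  ultimately show ?thesis by (simp add: is_form1_def smooth_on_def)
qed

section \<open>Functions with a prescribed logarithmic derivative\<close>

lemma openin_if_open_in_charts:
  assumes L: "smooth_manifold L" and "S \<subseteq> points L"
    and loc: "\<And>p. p \<in> S \<Longrightarrow> \<exists>c V. c \<in> charts_at L p \<and> open V \<and> chart_fun c p \<in> V \<and>
      (\<forall>q\<in>chart_dom c. chart_fun c q \<in> V \<longrightarrow> q \<in> S)"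
  shows "openin (mtop L) S"
proof (subst openin_subopen, intro ballI)
  fix p assume "p \<in> S"
  then obtain c V where cV: "c \<in> charts_at L p" "open V" "chart_fun c p \<in> V"
    "\<And>q. q \<in> chart_dom c \<Longrightarrow> chart_fun c q \<in> V \<Longrightarrow> q \<in> S" using loc by blast
  note c = charts_atD[OF L cV(1)]
  let ?T = "{q \<in> topspace (subtopology (mtop L) (chart_dom c)). chart_fun c q \<in> V}"
  have "openin (subtopology (mtop L) (chart_dom c)) ?T"
    using openin_continuous_map_preimage[OF chart_continuous[OF c(1)], of V] cV(2) by simp
  then have "openin (mtop L) ?T" by (rule openin_trans_full[OF _ chart_dom_open[OF c(1)]])
  moreover have "p \<in> ?T" using c cV(3) chart_dom_points[OF c(1)] by auto
  moreover have "?T \<subseteq> S" using cV(4) by auto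
  ultimately show "\<exists>T. openin (mtop L) T \<and> p \<in> T \<and> T \<subseteq> S" by blast
qed

lemma openin_nonzero_set:
  assumes L: "smooth_manifold L" and h: "smooth_fun L h"
  shows "openin (mtop L) {p \<in> points L. h p \<noteq> 0}"
proof (rule openin_if_open_in_charts[OF L])
  fix p assume "p \<in> {p \<in> points L. h p \<noteq> 0}"
  then have p: "p \<in> points L" "h p \<noteq> 0" by auto
  let ?c = "some_chart L p"
  note cp = some_chart_in[OF L p(1)]
  note c = charts_atD[OF L cp]
  let ?V = "{x \<in> chart_img ?c. (h \<circ> chart_inv ?c) x \<noteq> 0}"
  have "Ck_on 0 (chart_img ?c) (h \<circ> chart_inv ?c)"
    using h c(2) unfolding smooth_fun_def smooth_on_def by blast
  then have "open (chart_img ?c \<inter> (h \<circ> chart_inv ?c) -` (- {0}))"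
    by (intro continuous_open_preimage chart_img_open[OF c(1)]) auto
  moreover have "chart_img ?c \<inter> (h \<circ> chart_inv ?c) -` (- {0}) = ?V" by auto
  ultimately have "open ?V" by simp
  then show "\<exists>c V. c \<in> charts_at L p \<and> open V \<and> chart_fun c p \<in> V \<and>
      (\<forall>q\<in>chart_dom c. chart_fun c q \<in> V \<longrightarrow> q \<in> {p \<in> points L. h p \<noteq> 0})"
    using cp p c(3) chart_fun_in_img[OF c(3)] chart_dom_points[OF c(1)]
    by (intro exI[of _ ?c] exI[of _ ?V]) (auto simp: chart_inv_fun[OF c(1)])
qed auto

text \<open>In a chart the equation \<open>dh = h \<beta>\<close> bounds the derivative of \<open>h\<close> by a constant times \<open>\<bar>h\<bar>\<close>, because the
  coefficients of \<open>\<beta>\<close> are bounded near a point; so \<open>h\<close> vanishes around each of its zeros.\<close>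

lemma openin_zero_set:
  fixes L :: "('a, 'f::euclidean_space) manifold"
  assumes L: "smooth_manifold L" and h: "smooth_fun L h" and \<beta>: "is_form1 L \<beta>"
    and dh: "\<And>p v. p \<in> points L \<Longrightarrow> v \<in> tangent_space L p \<Longrightarrow> differential L h p v = h p * \<beta> p v"
  shows "openin (mtop L) {p \<in> points L. h p = 0}"
proof (rule openin_if_open_in_charts[OF L])
  fix p assume "p \<in> {p \<in> points L. h p = 0}"
  then have p: "p \<in> points L" "h p = 0" by auto
  define c where "c = some_chart L p"
  have cp: "c \<in> charts_at L p" unfolding c_def by (rule some_chart_in[OF L p(1)])
  note c = charts_atD[OF L cp]
  let ?g = "h \<circ> chart_inv c" and ?x0 = "chart_fun c p"
  have oU: "open (chart_img c)" by (rule chart_img_open[OF c(1)])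
  obtain r where r: "r > 0" "cball ?x0 r \<subseteq> chart_img c"
    using oU chart_fun_in_img[OF c(3)] open_contains_cball by blast
  have der: "(?g has_derivative frechet_derivative ?g (at x)) (at x)" if "x \<in> chart_img c" for x
    using smooth_fun_has_derivative[OF h charts_at_chart_inv[OF L c(2) that]] by (simp add: chart_fun_inv[OF c(1) that])
  have dg: "frechet_derivative ?g (at x) u = ?g x * coord1 L c \<beta> x u" if x: "x \<in> chart_img c" for x u
  proof -
    note q = charts_at_chart_inv[OF L c(2) x] chart_inv_in_points[OF L c(2) x]
    note cv = coord_vector_in_tangent_space[OF L q(1)]
    show ?thesis
      using dh[OF q(2) cv, of u] unfolding differential_in_chart[OF L h q(2,1) cv]
      by (simp add: coord1_def Let_def coord_vector_apply[OF L q(1)] chart_fun_inv[OF c(1) x])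
  qed
  have "\<exists>k. \<forall>x\<in>cball ?x0 r. norm (coord1 L c \<beta> x j) \<le> k" for j
  proof -
    have "continuous_on (cball ?x0 r) (\<lambda>x. coord1 L c \<beta> x j)"
      using coord1_smooth[OF \<beta> c(2), of 0 j] r(2) by (auto intro: continuous_on_subset)
    then have "bounded ((\<lambda>x. coord1 L c \<beta> x j) ` cball ?x0 r)"
      by (intro compact_imp_bounded compact_continuous_image) auto
    then show ?thesis by (auto simp: bounded_iff)
  qed
  then obtain k where k: "\<And>j x. x \<in> cball ?x0 r \<Longrightarrow> \<bar>coord1 L c \<beta> x j\<bar> \<le> k j" by (metis real_norm_def)
  define K where "K = (\<Sum>j\<in>Basis. k j)"
  have bound: "\<bar>frechet_derivative ?g (at x) u\<bar> \<le> K * \<bar>?g x\<bar> * norm u" if x: "x \<in> ball ?x0 r" for x u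
  proof -
    have xr: "x \<in> cball ?x0 r" using x by auto
    then have xi: "x \<in> chart_img c" using r(2) by auto
    have "coord1 L c \<beta> x u = (\<Sum>j\<in>Basis. (u \<bullet> j) *\<^sub>R coord1 L c \<beta> x j)"
      unfolding coord1_def Let_def
      by (rule linear_eq_sum_Basis[OF linear_form1[OF L \<beta> charts_at_chart_inv[OF L c(2) xi] chart_inv_in_points[OF L c(2) xi]]])
    also have "\<bar>\<dots>\<bar> \<le> (\<Sum>j\<in>Basis. \<bar>(u \<bullet> j) *\<^sub>R coord1 L c \<beta> x j\<bar>)" by (rule sum_abs)
    also have "\<dots> \<le> (\<Sum>j\<in>Basis. norm u * k j)"
      using k[OF xr] Basis_le_norm by (intro sum_mono) (auto simp: abs_mult intro!: mult_mono)
    also have "\<dots> = K * norm u" by (simp add: K_def sum_distrib_left sum_distrib_right mult.commute)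
    finally have "\<bar>coord1 L c \<beta> x u\<bar> \<le> K * norm u" .
    then have "\<bar>?g x\<bar> * \<bar>coord1 L c \<beta> x u\<bar> \<le> \<bar>?g x\<bar> * (K * norm u)" by (rule mult_left_mono) simp
    then show ?thesis by (simp add: dg[OF xi] abs_mult mult_ac)
  qed
  have x0: "?x0 \<in> ball ?x0 r" "?g ?x0 = 0" using r(1) p(2) by (auto simp: chart_inv_fun[OF c(1,3)])
  have der': "(?g has_derivative frechet_derivative ?g (at x)) (at x)" if "x \<in> ball ?x0 r" for x
    by (rule der) (use that r(2) in \<open>auto simp: subset_iff\<close>)
  have "\<exists>V. open V \<and> ?x0 \<in> V \<and> (\<forall>x\<in>V. ?g x = 0)"
    by (rule zero_near_zero_if_derivative_bounded[OF open_ball x0 der' bound])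
  then obtain V where V: "open V" "?x0 \<in> V" "\<forall>x\<in>V. ?g x = 0" by blast
  have "h q = 0" if "q \<in> chart_dom c" "chart_fun c q \<in> V" for q
    using bspec[OF V(3) that(2)] by (simp add: chart_inv_fun[OF c(1) that(1)])
  then show "\<exists>c V. c \<in> charts_at L p \<and> open V \<and> chart_fun c p \<in> V \<and>
      (\<forall>q\<in>chart_dom c. chart_fun c q \<in> V \<longrightarrow> q \<in> {p \<in> points L. h p = 0})"
    using cp V chart_dom_points[OF c(1)] by (intro exI[of _ c] exI[of _ V]) auto
qed auto

text \<open>A primitive is \<open>ln \<bar>h\<bar>\<close>.\<close>

lemma exact_if_logarithmic_derivative:
  assumes L: "smooth_manifold L" and h: "smooth_fun L h" and nz: "\<And>p. p \<in> points L \<Longrightarrow> h p \<noteq> 0"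
    and dh: "\<And>p v. p \<in> points L \<Longrightarrow> v \<in> tangent_space L p \<Longrightarrow> differential L h p v = h p * \<beta> p v"
  shows "exact_form1 L \<beta>"
proof -
  let ?f = "\<lambda>p. ln \<bar>h p\<bar>"
  have f: "smooth_fun L ?f"
    unfolding smooth_fun_def smooth_on_def
  proof (intro ballI allI)
    fix c k assume cL: "c \<in> atlas L"
    then have c: "is_chart (mtop L) c" using L by (simp add: smooth_manifold_def)
    have "Ck_on k (chart_img c) ((\<lambda>x. ln \<bar>x\<bar>) \<circ> (h \<circ> chart_inv c))"
    proof (rule Ck_on_compose[OF chart_img_open[OF c] _ _ Ck_on_ln_abs])
      show "(h \<circ> chart_inv c) ` chart_img c \<subseteq> - {0}"
        using nz chart_inv_in_points[OF L cL] by auto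
      show "Ck_on k (chart_img c) (h \<circ> chart_inv c)" using h cL by (simp add: smooth_fun_def smooth_on_def)
    qed
    then show "Ck_on k (chart_img c) (?f \<circ> chart_inv c)" by (simp add: o_def)
  qed
  have "\<beta> p v = differential L ?f p v" if p: "p \<in> points L" and v: "v \<in> tangent_space L p" for p v
  proof -
    define c where "c = some_chart L p"
    have c: "c \<in> charts_at L p" unfolding c_def by (rule some_chart_in[OF L p])
    have hp: "(h \<circ> chart_inv c) (chart_fun c p) = h p"
      using charts_atD[OF L c] by (simp add: chart_inv_fun)
    have "((\<lambda>x. ln \<bar>x\<bar>) \<circ> (h \<circ> chart_inv c) has_derivative
        (\<lambda>u. inverse (h p) * u) \<circ> frechet_derivative (h \<circ> chart_inv c) (at (chart_fun c p))) (at (chart_fun c p))"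
      using ln_abs_has_derivative[OF nz[OF p]]
      by (intro diff_chain_at smooth_fun_has_derivative[OF h c]) (simp only: hp)
    then have D: "(?f \<circ> chart_inv c has_derivative
        (\<lambda>u. inverse (h p) * u) \<circ> frechet_derivative (h \<circ> chart_inv c) (at (chart_fun c p))) (at (chart_fun c p))"
      by (simp only: o_def)
    have "differential L ?f p v = inverse (h p) * differential L h p v"
      by (simp add: differential_in_chart[OF L f p c v] differential_in_chart[OF L h p c v] frechet_eqI[OF D])
    then show ?thesis using dh[OF p v] nz[OF p] by simp
  qed
  then show ?thesis unfolding exact_form1_def using f by blast
qed

text \<open>The zero set of \<open>h\<close> is open and closed, so on a connected manifold \<open>h\<close> vanishes everywhere or
  nowhere; in the second case \<open>\<beta>\<close> would be exact.\<close>

lemma zero_if_logarithmic_derivative_not_exact: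
  assumes L: "smooth_manifold L" and conn: "connected_space (mtop L)"
    and h: "smooth_fun L h" and \<beta>: "is_form1 L \<beta>" "\<not> exact_form1 L \<beta>"
    and dh: "\<And>p v. p \<in> points L \<Longrightarrow> v \<in> tangent_space L p \<Longrightarrow> differential L h p v = h p * \<beta> p v"
    and p: "p \<in> points L"
  shows "h p = 0"
proof (rule ccontr)
  assume "h p \<noteq> 0"
  let ?Z = "{p \<in> points L. h p = 0}" and ?N = "{p \<in> points L. h p \<noteq> 0}"
  have "openin (mtop L) ?Z" "openin (mtop L) ?N"
    by (rule openin_zero_set[OF L h \<beta>(1) dh], assumption+, rule openin_nonzero_set[OF L h])
  moreover have "points L \<subseteq> ?Z \<union> ?N" "?Z \<inter> ?N = {}" "?N \<noteq> {}" using p \<open>h p \<noteq> 0\<close> by auto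
  ultimately have "?Z = {}" using conn unfolding connected_space_def by blast
  then have "exact_form1 L \<beta>"
    by (intro exact_if_logarithmic_derivative[OF L h _ dh]) auto
  with \<beta>(2) show False by blast
qed

section \<open>Isotropic invariant submanifolds\<close>

theorem corollary30:
  fixes M :: "('a, 'e::euclidean_space) manifold"
    and L :: "('a, 'f::euclidean_space) manifold"
    and \<eta> :: "('a, 'e) form1" and \<omega> :: "('a, 'e) form2"
    and H :: "'a \<Rightarrow> real" and X :: "'a \<Rightarrow> ('a, 'e) tvec"
  assumes "conformal_symplectic M \<eta> \<omega>"
    and "smooth_fun M H"
    and "hamiltonian_vector_field M \<eta> \<omega> H X"
    and "submanifold L M" and "connected_space (mtop L)"
    and "isotropic L M \<omega>"
    and "flow_invariant M X (points L)"
    and "\<not> exact_form1 L (pullback1 L M id \<eta>)"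
  shows "points L \<subseteq> {p \<in> points M. H p = 0}"
proof -
  have M: "smooth_manifold M" and \<eta>: "is_form1 M \<eta>" and \<omega>: "is_form2 M \<omega>" "nondegenerate M \<omega>"
    using assms(1) by (auto simp: conformal_symplectic_def)
  have XT: "X p \<in> tangent_space M p"
    and dual: "v \<in> tangent_space M p \<Longrightarrow> \<omega> p (X p) v = lee_deriv0 M \<eta> H p v"
    if "p \<in> points M" for p v
    using assms(3) that by (auto simp: hamiltonian_vector_field_def)
  note L = submanifoldD[OF assms(4)]
  \<comment> \<open>The restriction of \<open>dH - H \<eta>\<close> to \<open>L\<close> is \<open>\<omega>(X, \<cdot>)\<close>, and \<open>X\<close> is tangent to the isotropic \<open>L\<close>.\<close>
  have dH: "differential L H p v = H p * pullback1 L M id \<eta> p v"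
    if p: "p \<in> points L" and v: "v \<in> tangent_space L p" for p v
  proof -
    have pM: "p \<in> points M" using p L(2) by blast
    obtain I \<gamma> where \<gamma>: "integral_curve M X I \<gamma>" "0 \<in> I" "\<gamma> 0 = p"
      using integral_curve_of_dual_field_exists[OF M \<omega> is_form1_lee_deriv0[OF M \<eta> assms(2)] XT dual pM]
      by blast
    have "\<gamma> t \<in> points L" if "t \<in> I" for t
      using assms(7) p \<gamma> that unfolding flow_invariant_def flow_maps_def by blast
    with \<gamma> XT[OF pM] obtain u where u: "u \<in> tangent_space L p" "tangent_map L M id p u = X p"
      using integral_curve_in_submanifold_tangent[OF M assms(4), of X \<gamma> I] by blast
    let ?w = "tangent_map L M id p v"
    have w: "?w \<in> tangent_space M p" by (rule tangent_map_in_tangent_space[OF L(3,1) M p pM v])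
    have "0 = \<omega> p (tangent_map L M id p u) ?w"
      using assms(6) p u(1) v by (simp add: isotropic_def pullback2_def)
    also have "\<dots> = differential M H p ?w - H p * \<eta> p ?w"
      by (simp add: u(2) dual[OF pM w] lee_deriv0_def)
    finally show ?thesis
      by (simp add: pullback1_def differential_tangent_map[OF L(3,1) M p pM assms(2) v])
  qed
  have "H p = 0" if "p \<in> points L" for p
    by (rule zero_if_logarithmic_derivative_not_exact[OF L(1) assms(5) smooth_fun_restrict[OF L(3,1) M assms(2)]
          is_form1_pullback1[OF L(3,1) M \<eta>] assms(8) dH that])
  then show ?thesis using L(2) by blast
qed

end
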